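(* Let $s\in\mathbb{R}$, $k\ge0$, $k>s$, and let $\Phi\subset W_2^s(\mathbb{R}^d)$ be finite. If the FSI space $S_\Phi(W_2^s)$ provides approximation order $k$ (in $W_2^s(\mathbb{R}^d)$), then $S_\Phi(W_2^t)$ provides approximation order $k$ (in $W_2^t(\mathbb{R}^d)$) for any $t\le s$.
   Context: $\widehat f(\omega)=\int f(x)e^{-i\omega\cdot x}dx$. For $s\in\mathbb{R}$, $W_2^s=W_2^s(\mathbb{R}^d)$ is the space of tempered distributions $f$ with $\widehat f$ locally in $L_2(\mathbb{R}^d)$ and $\|f\|_{W_2^s}^2=\int(1+|\omega|)^{2s}|\widehat f(\omega)|^2d\omega<\infty$. For a finite $\Phi\subset W_2^s$, $S_\Phi(W_2^s)$ is the smallest closed subspace of $W_2^s$ containing $\Phi$ and invariant under integer translations (a finitely generated shift-invariant, FSI, space). For $k>s$, "$S_\Phi(W_2^s)$ provides approximation order $k$" means: with $S^h=\{g(\cdot/h):g\in S_\Phi(W_2^s)\}$, there is a constant $C$ such that $\inf_{g\in S^h}\|f-g\|_{W_2^s}\le Ch^{k-s}\|f\|_{W_2^k}$ for every $f\in W_2^k(\mathbb{R}^d)$ and every $h>0$. *)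

theory Defs
  imports "HOL-Analysis.Analysis"
begin

text \<open>Iterated partial derivatives; the list contains the coordinate directions, a multi-index
  being a list of elements of \<^const>\<open>Basis\<close> up to order.\<close>

fun partial_derivs :: "'a::euclidean_space list \<Rightarrow> ('a \<Rightarrow> complex) \<Rightarrow> 'a \<Rightarrow> complex" where
  "partial_derivs [] f = f"
| "partial_derivs (b # bs) f = (\<lambda>x. frechet_derivative (partial_derivs bs f) (at x) b)"

definition smooth_fun :: "('a::euclidean_space \<Rightarrow> complex) \<Rightarrow> bool" where
  "smooth_fun f \<longleftrightarrow> (\<forall>bs\<in>lists Basis. \<forall>x. partial_derivs bs f differentiable (at x))"

definition schwartz :: "('a::euclidean_space \<Rightarrow> complex) set" where
  "schwartz = {\<phi>. smooth_fun \<phi> \<and>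
     (\<forall>bs\<in>lists Basis. \<forall>m::nat. bounded (range (\<lambda>x. (1 + norm x) ^ m *\<^sub>R partial_derivs bs \<phi> x)))}"

definition test_fun :: "('a::euclidean_space \<Rightarrow> complex) set" where
  "test_fun = {\<phi>. smooth_fun \<phi> \<and> bounded {x. \<phi> x \<noteq> 0}}"

definition schwartz_tendsto ::
    "(nat \<Rightarrow> 'a::euclidean_space \<Rightarrow> complex) \<Rightarrow> ('a \<Rightarrow> complex) \<Rightarrow> bool" where
  "schwartz_tendsto \<phi> \<psi> \<longleftrightarrow>
     (\<forall>bs\<in>lists Basis. \<forall>m::nat.
        uniform_limit UNIV
          (\<lambda>n x. (1 + norm x) ^ m *\<^sub>R (partial_derivs bs (\<phi> n) x - partial_derivs bs \<psi> x))
          (\<lambda>x. 0) sequentially)"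

text \<open>A distribution is a functional on all functions, normalised to be \<open>0\<close> off the Schwartz
  space, so that equality of distributions is equality of functionals. Since the Schwartz space
  is metrizable, continuity is sequential continuity.\<close>

type_synonym 'a distr = "('a \<Rightarrow> complex) \<Rightarrow> complex"

definition tempered :: "'a::euclidean_space distr set" where
  "tempered = {T.
     (\<forall>\<phi>\<in>schwartz. \<forall>\<psi>\<in>schwartz. T (\<lambda>x. \<phi> x + \<psi> x) = T \<phi> + T \<psi>) \<and>
     (\<forall>c. \<forall>\<phi>\<in>schwartz. T (\<lambda>x. c * \<phi> x) = c * T \<phi>) \<and>
     (\<forall>\<phi> \<psi>. (\<forall>n. \<phi> n \<in> schwartz) \<longrightarrow> \<psi> \<in> schwartz \<longrightarrow> schwartz_tendsto \<phi> \<psi> \<longrightarrow>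
        (\<lambda>n. T (\<phi> n)) \<longlonglongrightarrow> T \<psi>) \<and>
     (\<forall>\<phi>. \<phi> \<notin> schwartz \<longrightarrow> T \<phi> = 0)}"

definition fourier :: "('a::euclidean_space \<Rightarrow> complex) \<Rightarrow> 'a \<Rightarrow> complex" where
  "fourier \<phi> \<omega> = (LINT x|lborel. \<phi> x * exp (- \<i> * of_real (\<omega> \<bullet> x)))"

definition fourier_distr :: "'a::euclidean_space distr \<Rightarrow> 'a distr" where
  "fourier_distr T \<phi> = (if \<phi> \<in> schwartz then T (fourier \<phi>) else 0)"

definition locally_L2 :: "('a::euclidean_space \<Rightarrow> complex) \<Rightarrow> bool" where
  "locally_L2 g \<longleftrightarrow> g \<in> borel_measurable lborel \<and>
     (\<forall>K. compact K \<longrightarrow> set_integrable lborel K (\<lambda>x. (cmod (g x))\<^sup>2))"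

definition represents :: "('a::euclidean_space \<Rightarrow> complex) \<Rightarrow> 'a distr \<Rightarrow> bool" where
  "represents g T \<longleftrightarrow> (\<forall>\<phi>\<in>test_fun. T \<phi> = (LINT x|lborel. g x * \<phi> x))"

text \<open>The locally square integrable function that coincides with the Fourier transform of \<open>T\<close>
  (if there is one); it is determined up to a null set.\<close>

definition fourier_fun :: "'a::euclidean_space distr \<Rightarrow> 'a \<Rightarrow> complex" where
  "fourier_fun T = (SOME g. locally_L2 g \<and> represents g (fourier_distr T))"

definition W2 :: "real \<Rightarrow> 'a::euclidean_space distr set" where
  "W2 s = {f \<in> tempered. (\<exists>g. locally_L2 g \<and> represents g (fourier_distr f)) \<and>
     integrable lborel (\<lambda>\<omega>. (1 + norm \<omega>) powr (2 * s) * (cmod (fourier_fun f \<omega>))\<^sup>2)}"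

definition W2_norm :: "real \<Rightarrow> 'a::euclidean_space distr \<Rightarrow> real" where
  "W2_norm s f =
     sqrt (LINT \<omega>|lborel. (1 + norm \<omega>) powr (2 * s) * (cmod (fourier_fun f \<omega>))\<^sup>2)"

definition W2_dist :: "real \<Rightarrow> 'a::euclidean_space distr \<Rightarrow> 'a distr \<Rightarrow> real" where
  "W2_dist s f g = W2_norm s (\<lambda>\<phi>. f \<phi> - g \<phi>)"

definition closed_subspace_W2 :: "real \<Rightarrow> 'a::euclidean_space distr set \<Rightarrow> bool" where
  "closed_subspace_W2 s V \<longleftrightarrow>
     V \<subseteq> W2 s \<and> (\<lambda>\<phi>. 0) \<in> V \<and>
     (\<forall>f\<in>V. \<forall>g\<in>V. (\<lambda>\<phi>. f \<phi> + g \<phi>) \<in> V) \<and>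
     (\<forall>c. \<forall>f\<in>V. (\<lambda>\<phi>. c * f \<phi>) \<in> V) \<and>
     (\<forall>F. \<forall>f\<in>W2 s. (\<forall>n::nat. F n \<in> V) \<longrightarrow> (\<lambda>n. W2_dist s (F n) f) \<longlonglongrightarrow> 0 \<longrightarrow> f \<in> V)"

text \<open>The translate \<open>f(\<cdot> - \<alpha>)\<close> and the dilate \<open>f(\<cdot> / h)\<close> of a distribution \<open>f\<close>: the formulas
  are the substitution rules for \<open>\<integral> f(x - \<alpha>) \<phi>(x) dx\<close> and \<open>\<integral> f(x / h) \<phi>(x) dx\<close>.\<close>

definition translate :: "'a::euclidean_space \<Rightarrow> 'a distr \<Rightarrow> 'a distr" where
  "translate \<alpha> f = (\<lambda>\<phi>. f (\<lambda>x. \<phi> (x + \<alpha>)))"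

definition dilate :: "real \<Rightarrow> 'a::euclidean_space distr \<Rightarrow> 'a distr" where
  "dilate h f = (\<lambda>\<phi>. of_real (h ^ DIM('a)) * f (\<lambda>x. \<phi> (h *\<^sub>R x)))"

definition shift_invariant :: "(real ^ 'n::finite) distr set \<Rightarrow> bool" where
  "shift_invariant V \<longleftrightarrow> (\<forall>\<alpha>. (\<forall>i. \<alpha> $ i \<in> \<int>) \<longrightarrow> (\<forall>f\<in>V. translate \<alpha> f \<in> V))"

definition SI_space :: "real \<Rightarrow> (real ^ 'n::finite) distr set \<Rightarrow> (real ^ 'n) distr set" where
  "SI_space s \<Phi> = \<Inter>{V. closed_subspace_W2 s V \<and> shift_invariant V \<and> \<Phi> \<subseteq> V}"

definition provides_approximation_order ::
    "real \<Rightarrow> real \<Rightarrow> (real ^ 'n::finite) distr set \<Rightarrow> bool" where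
  "provides_approximation_order s k S \<longleftrightarrow>
     (\<exists>C::real. \<forall>f\<in>W2 k. \<forall>h>0.
        (INF g\<in>dilate h ` S. W2_dist s f g) \<le> C * h powr (k - s) * W2_norm k f)"

end

theory Submission
  imports Defs "HOL-Probability.Characteristic_Functions" "HOL-Probability.Sinc_Integral"
begin

text \<open>
  Approximation order \<open>k\<close> in the norm of order \<open>t < s\<close> asks for an error that is smaller by
  \<open>h powr (s - t)\<close> than the error granted in the norm of order \<open>s\<close>. For the frequencies
  \<open>norm w \<ge> \<epsilon> / h\<close> of the error this gain is automatic: there the two weights differ by a factor of
  that size. The low frequencies of the error are the issue. They form an element of \<open>W2 k\<close>, and
  their norm of order \<open>k\<close> exceeds their norm of order \<open>s\<close> by at most a factor of size
  \<open>(\<epsilon> / h) powr (k - s)\<close>. As the error in the norm of order \<open>s\<close> is \<open>C * h powr (k - s)\<close> times the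
  norm of \<open>f\<close> in \<open>W2 k\<close>, for small \<open>\<epsilon>\<close> the low part has at most half the \<open>W2 k\<close> norm of \<open>f\<close>. It
  can therefore be approximated in the same manner, and so on; the high parts of all errors add up to
  a geometric series. This is \<open>approximation_transfer\<close>. It approximates by elements of the dilates of
  \<open>SI_space s \<Phi>\<close>, which is contained in \<open>SI_space t \<Phi>\<close> because the norm of order \<open>t\<close> is weaker
  (\<open>SI_space_mono\<close>).

  The argument manipulates Fourier transforms as functions, and most of what follows justifies this.
  The function representing a Fourier transform is unique up to null sets (\<open>fundamental_lemma\<close>, by
  bump functions), hence norms of sums, translates and dilates can be computed from any
  representatives. Cutting off high frequencies leads to a tempered distribution again
  (\<open>has_fourier_fun_exists\<close>): the inverse Fourier transform of a compactly supported square
  integrable function is a bounded function. That its Fourier transform is the given function means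
  Fourier inversion for test functions (\<open>fourier_inversion\<close>, by Gaussian regularisation), together
  with the fact that the Fourier transform maps test functions to Schwartz functions
  (\<open>fourier_test_schwartz\<close>).
\<close>

section \<open>Smooth functions\<close>

definition dir_deriv :: "'a::euclidean_space \<Rightarrow> ('a \<Rightarrow> complex) \<Rightarrow> 'a \<Rightarrow> complex" where
  "dir_deriv b f = (\<lambda>x. frechet_derivative f (at x) b)"

lemma dir_deriv_eqI:
  assumes "\<And>x. (f has_derivative f' x) (at x)"
  shows "dir_deriv b f = (\<lambda>x. f' x b)"
  unfolding dir_deriv_def by (rule ext) (simp add: frechet_derivative_at[OF assms, symmetric])

lemma partial_derivs_Cons: "partial_derivs (b # bs) f = dir_deriv b (partial_derivs bs f)"
  by (simp add: dir_deriv_def)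

lemma partial_derivs_snoc: "partial_derivs (bs @ [b]) f = partial_derivs bs (dir_deriv b f)"
  by (induction bs) (simp_all add: dir_deriv_def)

text \<open>Smoothness demands differentiability of all iterated derivatives. Instead of computing them one
  exhibits a class of differentiable functions that contains its own directional derivatives.\<close>

lemma smooth_fun_coinduct:
  assumes "X f"
    and diff: "\<And>f x. X f \<Longrightarrow> f differentiable (at x)"
    and deriv: "\<And>f b. X f \<Longrightarrow> b \<in> Basis \<Longrightarrow> X (dir_deriv b f)"
  shows "smooth_fun f"
proof -
  have "X (partial_derivs bs f)" if "bs \<in> lists Basis" for bs
    using that by (induction bs) (auto simp: \<open>X f\<close> partial_derivs_Cons simp del: partial_derivs.simps(2) intro: deriv)
  then show ?thesis
    unfolding smooth_fun_def using diff by blast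
qed

lemma smooth_fun_differentiable: "smooth_fun f \<Longrightarrow> f differentiable (at x)"
  unfolding smooth_fun_def by (metis lists.Nil partial_derivs.simps(1))

lemma smooth_fun_has_derivative:
  "smooth_fun f \<Longrightarrow> (f has_derivative (frechet_derivative f (at x))) (at x)"
  using smooth_fun_differentiable frechet_derivative_works by blast

lemma smooth_fun_dir_deriv:
  assumes "smooth_fun f" "b \<in> Basis"
  shows "smooth_fun (dir_deriv b f)"
  unfolding smooth_fun_def
proof (intro ballI allI)
  fix bs :: "'a list" and x
  assume "bs \<in> lists Basis"
  then have "bs @ [b] \<in> lists Basis"
    using assms(2) by auto
  then show "partial_derivs bs (dir_deriv b f) differentiable (at x)"
    using assms(1) unfolding smooth_fun_def partial_derivs_snoc[symmetric] by blast
qed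

lemma smooth_fun_partial_derivs:
  "smooth_fun f \<Longrightarrow> bs \<in> lists Basis \<Longrightarrow> smooth_fun (partial_derivs bs f)"
  by (induction bs) (auto simp: partial_derivs_Cons simp del: partial_derivs.simps(2) intro: smooth_fun_dir_deriv)

lemma smooth_fun_continuous: "smooth_fun f \<Longrightarrow> continuous_on S f"
  by (meson smooth_fun_differentiable continuous_at_imp_continuous_on differentiable_imp_continuous_within)

lemma dir_deriv_add:
  assumes "smooth_fun f" "smooth_fun g"
  shows "dir_deriv b (\<lambda>x. f x + g x) = (\<lambda>x. dir_deriv b f x + dir_deriv b g x)"
  unfolding dir_deriv_def
  using dir_deriv_eqI[OF has_derivative_add[OF smooth_fun_has_derivative[OF assms(1)] smooth_fun_has_derivative[OF assms(2)]], of b]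
  by (simp add: dir_deriv_def)

lemma dir_deriv_mult:
  assumes "smooth_fun f" "smooth_fun g"
  shows "dir_deriv b (\<lambda>x. f x * g x) = (\<lambda>x. f x * dir_deriv b g x + dir_deriv b f x * g x)"
  using dir_deriv_eqI[OF has_derivative_mult[OF smooth_fun_has_derivative[OF assms(1)] smooth_fun_has_derivative[OF assms(2)]], of b]
  by (simp add: dir_deriv_def)

lemma smooth_fun_add:
  assumes "smooth_fun f" "smooth_fun g"
  shows "smooth_fun (\<lambda>x. f x + g x)"
proof (rule smooth_fun_coinduct[where X="\<lambda>h. \<exists>f g. smooth_fun f \<and> smooth_fun g \<and> h = (\<lambda>x. f x + g x)"])
  fix h :: "'a \<Rightarrow> complex"
  assume "\<exists>f g. smooth_fun f \<and> smooth_fun g \<and> h = (\<lambda>x. f x + g x)"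
  then obtain f g where *: "smooth_fun f" "smooth_fun g" and h: "h = (\<lambda>x. f x + g x)"
    by blast
  show "h differentiable at x" for x
    unfolding h by (intro differentiable_add smooth_fun_differentiable *)
  show "\<exists>f g. smooth_fun f \<and> smooth_fun g \<and> dir_deriv b h = (\<lambda>x. f x + g x)" if "b \<in> Basis" for b
    unfolding h dir_deriv_add[OF *] using smooth_fun_dir_deriv[OF _ that] * by blast
qed (use assms in blast)

text \<open>The Leibniz rule leads from products to sums of products, so the class to which coinduction
  applies has to contain the latter.\<close>

inductive sum_of_products :: "('a::euclidean_space \<Rightarrow> complex) \<Rightarrow> bool" where
  prod: "smooth_fun f \<Longrightarrow> smooth_fun g \<Longrightarrow> sum_of_products (\<lambda>x. f x * g x)"
| add: "sum_of_products f \<Longrightarrow> sum_of_products g \<Longrightarrow> sum_of_products (\<lambda>x. f x + g x)"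

lemma sum_of_products_deriv:
  assumes "sum_of_products f"
  shows "(\<forall>x. f differentiable (at x)) \<and> (\<forall>b\<in>Basis. sum_of_products (dir_deriv b f))"
  using assms
proof induction
  case (prod f g)
  then show ?case
    by (auto simp: dir_deriv_mult intro!: sum_of_products.intros differentiable_mult intro: smooth_fun_differentiable smooth_fun_dir_deriv)
next
  case (add f g)
  have "dir_deriv b (\<lambda>x. f x + g x) = (\<lambda>x. dir_deriv b f x + dir_deriv b g x)" for b
  proof -
    have "(f has_derivative (frechet_derivative f (at x))) (at x)"
        "(g has_derivative (frechet_derivative g (at x))) (at x)" for x
      using add.IH frechet_derivative_works by blast+
    from dir_deriv_eqI[OF has_derivative_add[OF this]] show ?thesis
      by (simp add: dir_deriv_def)
  qed
  with add show ?case
    by (auto intro!: sum_of_products.intros)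
qed

lemma smooth_fun_mult:
  assumes "smooth_fun f" "smooth_fun g"
  shows "smooth_fun (\<lambda>x. f x * g x)"
  by (rule smooth_fun_coinduct[where X=sum_of_products])
    (use assms sum_of_products_deriv sum_of_products.intros in blast)+

lemma dir_deriv_const: "dir_deriv b (\<lambda>x. c) = (\<lambda>x. 0)"
  by (subst dir_deriv_eqI[OF has_derivative_const]) simp

lemma smooth_fun_const: "smooth_fun (\<lambda>x. c)"
  by (rule smooth_fun_coinduct[where X="\<lambda>h. \<exists>c. h = (\<lambda>x. c)"]) (auto simp: dir_deriv_const)

lemma smooth_fun_cmult: "smooth_fun f \<Longrightarrow> smooth_fun (\<lambda>x. c * f x)"
  by (intro smooth_fun_mult smooth_fun_const)

lemma dir_deriv_cmult: "smooth_fun f \<Longrightarrow> dir_deriv b (\<lambda>x. c * f x) = (\<lambda>x. c * dir_deriv b f x)"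
  by (simp add: dir_deriv_mult smooth_fun_const dir_deriv_const)

lemma smooth_fun_prod:
  "finite A \<Longrightarrow> (\<And>i. i \<in> A \<Longrightarrow> smooth_fun (f i)) \<Longrightarrow> smooth_fun (\<lambda>x. \<Prod>i\<in>A. f i x)"
  by (induction rule: finite_induct) (auto intro: smooth_fun_const smooth_fun_mult)

lemma dir_deriv_inner: "dir_deriv b (\<lambda>x. complex_of_real (x \<bullet> e)) = (\<lambda>x. complex_of_real (b \<bullet> e))"
  by (rule dir_deriv_eqI) (auto intro!: derivative_eq_intros)

lemma smooth_fun_inner: "smooth_fun (\<lambda>x. complex_of_real (x \<bullet> e))"
proof (rule smooth_fun_coinduct[where X="\<lambda>h. h = (\<lambda>x. complex_of_real (x \<bullet> e)) \<or> (\<exists>c. h = (\<lambda>x. c))"])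
  show "f differentiable at x" if "f = (\<lambda>x. complex_of_real (x \<bullet> e)) \<or> (\<exists>c. f = (\<lambda>x. c))" for f x
    using that
  proof
    assume f: "f = (\<lambda>x. complex_of_real (x \<bullet> e))"
    have "bounded_linear (\<lambda>x. complex_of_real (x \<bullet> e))"
      by (rule bounded_linear_compose[OF bounded_linear_of_real bounded_linear_inner_left])
    then show ?thesis
      unfolding f by (rule bounded_linear_imp_differentiable)
  qed auto
qed (auto simp: dir_deriv_const dir_deriv_inner)

lemma character_has_derivative:
  "((\<lambda>x. exp (\<i> * complex_of_real (x \<bullet> w))) has_derivative
     (\<lambda>v. (\<i> * complex_of_real (v \<bullet> w)) * exp (\<i> * complex_of_real (x \<bullet> w)))) (at x)"
proof -
  have "bounded_linear (\<lambda>x. \<i> * complex_of_real (x \<bullet> w))"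
    by (intro bounded_linear_mult_right[THEN bounded_linear_compose]
        bounded_linear_compose[OF bounded_linear_of_real bounded_linear_inner_left])
  from has_derivative_compose[OF bounded_linear_imp_has_derivative[OF this]
      DERIV_exp[unfolded has_field_derivative_def]]
  show ?thesis
    by (simp add: mult.commute)
qed

lemma dir_deriv_character:
  "dir_deriv b (\<lambda>x. exp (\<i> * complex_of_real (x \<bullet> w)))
     = (\<lambda>x. (\<i> * complex_of_real (b \<bullet> w)) * exp (\<i> * complex_of_real (x \<bullet> w)))"
  by (rule dir_deriv_eqI) (rule character_has_derivative)

lemma smooth_fun_character: "smooth_fun (\<lambda>x. exp (\<i> * complex_of_real (x \<bullet> w)))"
proof (rule smooth_fun_coinduct[where X="\<lambda>h. \<exists>c. h = (\<lambda>x. c * exp (\<i> * complex_of_real (x \<bullet> w)))"])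
  fix h :: "'a \<Rightarrow> complex" 
  assume "\<exists>c. h = (\<lambda>x. c * exp (\<i> * complex_of_real (x \<bullet> w)))"
  then obtain c where c: "h = (\<lambda>x. c * exp (\<i> * complex_of_real (x \<bullet> w)))" by blast
  have d: "(h has_derivative (\<lambda>v. c * ((\<i> * complex_of_real (v \<bullet> w)) * exp (\<i> * complex_of_real (x \<bullet> w))))) (at x)" for x
    unfolding c by (intro has_derivative_mult_right character_has_derivative)
  then show "h differentiable at x" for x
    unfolding differentiable_def by blast
  show "\<exists>c. dir_deriv b h = (\<lambda>x. c * exp (\<i> * complex_of_real (x \<bullet> w)))" for b
    unfolding dir_deriv_eqI[OF d] by (intro exI[of _ "c * (\<i> * complex_of_real (b \<bullet> w))"]) (simp add: mult_ac)
qed (auto intro: exI[of _ 1])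

lemma has_derivative_affine_compose:
  assumes "smooth_fun f"
  shows "((\<lambda>x. f (c *\<^sub>R x + a)) has_derivative
      (\<lambda>v. frechet_derivative f (at (c *\<^sub>R x + a)) (c *\<^sub>R v))) (at x)"
proof -
  have "((\<lambda>x. c *\<^sub>R x + a) has_derivative (\<lambda>v. c *\<^sub>R v)) (at x)"
    by (intro has_derivative_add_const has_derivative_scaleR_right has_derivative_ident)
  from has_derivative_compose[OF this smooth_fun_has_derivative[OF assms]] show ?thesis .
qed

lemma dir_deriv_affine:
  assumes "smooth_fun f"
  shows "dir_deriv b (\<lambda>x. f (c *\<^sub>R x + a)) = (\<lambda>x. of_real c * dir_deriv b f (c *\<^sub>R x + a))"
proof -
  have "linear (frechet_derivative f (at x))" for x
    using smooth_fun_has_derivative[OF assms] has_derivative_linear by blast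
  then show ?thesis
    unfolding dir_deriv_eqI[OF has_derivative_affine_compose[OF assms]] dir_deriv_def
    by (auto simp: linear_scale scaleR_conv_of_real)
qed

text \<open>The induction for the formula differentiates derivatives of \<open>f\<close> after the substitution, and so
  relies on their smoothness.\<close>

lemma partial_derivs_affine:
  assumes "smooth_fun f" "bs \<in> lists Basis"
  shows "partial_derivs bs (\<lambda>x. f (c *\<^sub>R x + a))
           = (\<lambda>x. of_real (c ^ length bs) * partial_derivs bs f (c *\<^sub>R x + a)) \<and>
         smooth_fun (\<lambda>x. f (c *\<^sub>R x + a))"
proof -
  have sm: "smooth_fun (\<lambda>x. f (c *\<^sub>R x + a))" if "smooth_fun f" for f
  proof (rule smooth_fun_coinduct[where X="\<lambda>h. \<exists>k f. smooth_fun f \<and> h = (\<lambda>x. k * f (c *\<^sub>R x + a))"])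
    fix h :: "'a \<Rightarrow> complex"
    assume "\<exists>k f. smooth_fun f \<and> h = (\<lambda>x. k * f (c *\<^sub>R x + a))"
    then obtain k f where f: "smooth_fun f" and h: "h = (\<lambda>x. k * f (c *\<^sub>R x + a))" by blast
    have h': "h = (\<lambda>x. (\<lambda>y. k * f y) (c *\<^sub>R x + a))" by (simp add: h)
    show "h differentiable at x" for x
      unfolding h' differentiable_def
      using has_derivative_affine_compose[OF smooth_fun_cmult[OF f, of k]] by blast
    show "\<exists>k f. smooth_fun f \<and> dir_deriv b h = (\<lambda>x. k * f (c *\<^sub>R x + a))" if "b \<in> Basis" for b
      unfolding h' using dir_deriv_affine[OF smooth_fun_cmult[OF f, of k], of b c a]
      by (intro exI[of _ "of_real c"] exI[of _ "dir_deriv b (\<lambda>y. k * f y)"])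
        (auto intro: smooth_fun_dir_deriv smooth_fun_cmult f that)
  qed (rule exI[of _ 1], rule exI[of _ f], simp add: that)
  have "partial_derivs bs (\<lambda>x. f (c *\<^sub>R x + a))
           = (\<lambda>x. of_real (c ^ length bs) * partial_derivs bs f (c *\<^sub>R x + a))"
    using assms(2)
  proof (induction bs)
    case (Cons b bs)
    show ?case
      unfolding partial_derivs_Cons Cons
      using smooth_fun_partial_derivs[OF assms(1) Cons.hyps(2)]
      by (simp add: dir_deriv_cmult dir_deriv_affine sm mult_ac)
  qed simp
  with sm[OF assms(1)] show ?thesis by simp
qed

lemma smooth_fun_affine: "smooth_fun f \<Longrightarrow> smooth_fun (\<lambda>x. f (c *\<^sub>R x + a))"
  using partial_derivs_affine[of f "[]" c a] by simp

lemma partial_derivs_add: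
  assumes "smooth_fun f" "smooth_fun g" "bs \<in> lists Basis"
  shows "partial_derivs bs (\<lambda>x. f x + g x) = (\<lambda>x. partial_derivs bs f x + partial_derivs bs g x)"
  using assms(3)
  by (induction bs) (simp_all add: partial_derivs_Cons dir_deriv_add smooth_fun_partial_derivs assms del: partial_derivs.simps(2))

lemma partial_derivs_cmult:
  assumes "smooth_fun f" "bs \<in> lists Basis"
  shows "partial_derivs bs (\<lambda>x. c * f x) = (\<lambda>x. c * partial_derivs bs f x)"
  using assms(2)
  by (induction bs) (simp_all add: partial_derivs_Cons dir_deriv_cmult smooth_fun_partial_derivs assms del: partial_derivs.simps(2))

section \<open>Bump functions\<close>

text \<open>The derivatives of \<open>exp (- 1 / u)\<close> are this function times polynomials in \<open>1 / u\<close>. With the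
  polynomial as a parameter the family is closed under differentiation, also at \<open>0\<close>.\<close>

definition flat_exp :: "real poly \<Rightarrow> real \<Rightarrow> real" where
  "flat_exp p u = (if u > 0 then poly p (1 / u) * exp (- 1 / u) else 0)"

lemma poly_exp_tendsto_0: "((\<lambda>v. poly p v * exp (- v)) \<longlongrightarrow> (0::real)) at_top"
proof -
  have "((\<lambda>v. \<Sum>i\<le>degree p. coeff p i * (v ^ i / exp v)) \<longlongrightarrow> (\<Sum>i\<le>degree p. coeff p i * 0)) at_top"
    by (intro tendsto_intros tendsto_power_div_exp_0)
  moreover have "(\<lambda>v. \<Sum>i\<le>degree p. coeff p i * (v ^ i / exp v)) = (\<lambda>v. poly p v * exp (- v))"
    by (rule ext) (simp add: poly_altdef sum_distrib_right exp_minus divide_inverse mult.assoc)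
  ultimately show ?thesis
    by simp
qed

lemma flat_tendsto_0: "(flat_exp p \<longlongrightarrow> 0) (at 0)"
proof -
  have "((\<lambda>u. poly p (inverse u) * exp (- inverse u)) \<longlongrightarrow> 0) (at_right 0)"
    by (rule filterlim_compose[OF poly_exp_tendsto_0 filterlim_inverse_at_top_right])
  moreover have "eventually (\<lambda>u. poly p (inverse u) * exp (- inverse u) = flat_exp p u) (at_right 0)"
    using eventually_at_right_less[of "0::real"]
    by eventually_elim (simp add: flat_exp_def divide_inverse)
  ultimately have "(flat_exp p \<longlongrightarrow> 0) (at_right 0)"
    by (rule Lim_transform_eventually)
  moreover have "eventually (\<lambda>u. u < 0) (at_left (0::real))"
    by (simp add: eventually_at_filter)
  then have "eventually (\<lambda>u. flat_exp p u = 0) (at_left 0)"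
    by eventually_elim (simp add: flat_exp_def)
  then have "(flat_exp p \<longlongrightarrow> 0) (at_left 0)"
    by (rule tendsto_eventually)
  ultimately show ?thesis
    by (simp add: filterlim_split_at)
qed

lemma flat_has_derivative:
  "(flat_exp p has_real_derivative flat_exp ([:0, 0, 1:] * (p - pderiv p)) u) (at u)"
proof (cases u "0::real" rule: linorder_cases)
  case less
  have "(flat_exp p has_real_derivative 0) (at u)"
    by (rule has_field_derivative_transform_within_open[of "\<lambda>u. 0" _ _ "{..<0}"])
      (use less in \<open>auto simp: flat_exp_def\<close>)
  then show ?thesis
    using less by (simp add: flat_exp_def)
next
  case greater
  have i: "((\<lambda>u. 1 / u) has_real_derivative - (1 / u\<^sup>2)) (at u)"
    using greater by (auto intro!: derivative_eq_intros simp: power2_eq_square)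
  have e: "((\<lambda>u. exp (- 1 / u)) has_real_derivative exp (- 1 / u) * (1 / u\<^sup>2)) (at u)"
    using greater by (auto intro!: derivative_eq_intros simp: power2_eq_square)
  have "((\<lambda>u. poly p (1/u) * exp (- 1 / u)) has_real_derivative
      (poly (pderiv p) (1/u) * - (1/u^2)) * exp (-1/u) + exp (-1/u) * (1/u^2) * poly p (1/u)) (at u)"
    by (rule DERIV_mult[OF DERIV_chain2[OF poly_DERIV i] e])
  then have "(flat_exp p has_real_derivative
      (poly (pderiv p) (1/u) * - (1/u^2)) * exp (-1/u) + exp (-1/u) * (1/u^2) * poly p (1/u)) (at u)"
    by (rule has_field_derivative_transform_within_open[of _ _ _ "{0<..}"])
      (use greater in \<open>auto simp: flat_exp_def\<close>)
  moreover have "(poly (pderiv p) (1/u) * - (1/u^2)) * exp (-1/u) + exp (-1/u) * (1/u^2) * poly p (1/u)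
     = flat_exp ([:0, 0, 1:] * (p - pderiv p)) u"
    using greater by (simp add: flat_exp_def power2_eq_square divide_inverse algebra_simps)
  ultimately show ?thesis
    by simp
next
  case equal
  have "(flat_exp ([:0, 1:] * p) \<longlongrightarrow> 0) (at 0)"
    by (rule flat_tendsto_0)
  moreover have "flat_exp ([:0, 1:] * p) = (\<lambda>h. (flat_exp p (0 + h) - flat_exp p 0) / h)"
    by (rule ext) (simp add: flat_exp_def)
  ultimately show ?thesis
    by (simp add: equal DERIV_def flat_exp_def)
qed

lemma smooth_fun_flat:
  fixes e :: "'a::euclidean_space"
  shows "smooth_fun (\<lambda>x. complex_of_real (flat_exp p (x \<bullet> e - a)))"
proof (rule smooth_fun_coinduct[where X="\<lambda>h. \<exists>p. h = (\<lambda>x. complex_of_real (flat_exp p (x \<bullet> e - a)))"])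
  fix h :: "'a \<Rightarrow> complex"
  assume "\<exists>p. h = (\<lambda>x. complex_of_real (flat_exp p (x \<bullet> e - a)))"
  then obtain p where h: "h = (\<lambda>x. complex_of_real (flat_exp p (x \<bullet> e - a)))" by blast
  let ?q = "[:0, 0, 1:] * (p - pderiv p)"
  have "((\<lambda>x. flat_exp p (x \<bullet> e - a)) has_derivative (\<lambda>v. flat_exp ?q (x \<bullet> e - a) * (v \<bullet> e))) (at x)" for x
  proof -
    have "((\<lambda>x. x \<bullet> e - a) has_derivative (\<lambda>v. v \<bullet> e)) (at x)"
      by (auto intro!: derivative_eq_intros)
    from has_derivative_compose[OF this flat_has_derivative[of p "x \<bullet> e - a", unfolded has_field_derivative_def]]
    show ?thesis .
  qed
  then have d: "(h has_derivative (\<lambda>v. complex_of_real (flat_exp ?q (x \<bullet> e - a) * (v \<bullet> e)))) (at x)" for x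
    unfolding h by (rule has_derivative_of_real)
  then show "h differentiable at x" for x
    unfolding differentiable_def by blast
  have s: "flat_exp ?q u * c = flat_exp (smult c ?q) u" for u c
    unfolding flat_exp_def by simp
  show "\<exists>p. dir_deriv b h = (\<lambda>x. complex_of_real (flat_exp p (x \<bullet> e - a)))" for b
    unfolding dir_deriv_eqI[OF d] s by blast
qed blast

section \<open>Test functions\<close>

lemma test_fun_smooth: "\<phi> \<in> test_fun \<Longrightarrow> smooth_fun \<phi>"
  by (simp add: test_fun_def)

lemma test_fun_mult:
  assumes "\<phi> \<in> test_fun" "smooth_fun f"
  shows "(\<lambda>x. \<phi> x * f x) \<in> test_fun"
  using assms unfolding test_fun_def
  by (auto intro: smooth_fun_mult bounded_subset)

lemma dir_deriv_eq_0:
  assumes "closed S" "\<And>x. x \<notin> S \<Longrightarrow> f x = 0" "x \<notin> S"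
  shows "dir_deriv b f x = 0"
proof -
  have "open (- S)" using assms(1) by (simp add: open_Compl)
  have "((\<lambda>x. 0) has_derivative (\<lambda>v. 0)) (at x)" by simp
  then have "(f has_derivative (\<lambda>v. 0)) (at x)"
    by (rule has_derivative_transform_within_open[OF _ \<open>open (- S)\<close>]) (use assms in auto)
  then show ?thesis
    unfolding dir_deriv_def by (simp add: frechet_derivative_at[symmetric])
qed

lemma test_fun_dir_deriv:
  assumes "\<phi> \<in> test_fun" "b \<in> Basis"
  shows "dir_deriv b \<phi> \<in> test_fun"
proof -
  let ?S = "closure {x. \<phi> x \<noteq> 0}"
  have "{x. dir_deriv b \<phi> x \<noteq> 0} \<subseteq> ?S"
  proof
    fix x
    assume x: "x \<in> {x. dir_deriv b \<phi> x \<noteq> 0}"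
    show "x \<in> ?S"
    proof (rule ccontr)
      assume "x \<notin> ?S"
      moreover have "\<phi> y = 0" if "y \<notin> ?S" for y
        using that closure_subset[of "{x. \<phi> x \<noteq> 0}", THEN subsetD, of y] by (metis mem_Collect_eq)
      ultimately have "dir_deriv b \<phi> x = 0"
        by (intro dir_deriv_eq_0[OF closed_closure])
      with x show False by simp
    qed
  qed
  moreover have "bounded ?S"
    using assms(1) by (auto simp: test_fun_def intro: bounded_closure)
  ultimately show ?thesis
    using assms by (auto simp: test_fun_def intro: smooth_fun_dir_deriv bounded_subset)
qed

lemma test_fun_partial_derivs:
  "\<phi> \<in> test_fun \<Longrightarrow> bs \<in> lists Basis \<Longrightarrow> partial_derivs bs \<phi> \<in> test_fun"
  by (induction bs) (auto simp: partial_derivs_Cons simp del: partial_derivs.simps(2) intro: test_fun_dir_deriv)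

lemma test_fun_affine:
  assumes "\<phi> \<in> test_fun" "c \<noteq> 0"
  shows "(\<lambda>x. \<phi> (c *\<^sub>R x + a)) \<in> test_fun"
proof -
  have "x = (1 / c) *\<^sub>R ((c *\<^sub>R x + a) - a)" for x
    using assms(2) by simp
  then have "{x. \<phi> (c *\<^sub>R x + a) \<noteq> 0} \<subseteq> (\<lambda>y. (1 / c) *\<^sub>R (y - a)) ` {x. \<phi> x \<noteq> 0}"
    unfolding image_def by blast
  moreover have "bounded ((\<lambda>y. (1 / c) *\<^sub>R (y - a)) ` {x. \<phi> x \<noteq> 0})"
  proof -
    have "bounded {x. \<phi> x \<noteq> 0}" using assms(1) by (simp add: test_fun_def)
    from bounded_scaling[OF bounded_translation[OF this, of "- a"], of "1/c"]
    show ?thesis by (simp add: image_image)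
  qed
  ultimately show ?thesis
    using assms(1) by (auto simp: test_fun_def intro: smooth_fun_affine bounded_subset)
qed

lemma test_fun_bounded_support:
  assumes "\<phi> \<in> test_fun"
  obtains R where "R > 0" "\<And>x. norm x > R \<Longrightarrow> \<phi> x = 0"
  using assms unfolding test_fun_def bounded_pos by force

lemma test_fun_bounded:
  assumes "\<phi> \<in> test_fun"
  obtains B where "B > 0" "\<And>x. norm (\<phi> x) \<le> B"
proof -
  obtain R where R: "R > 0" "\<And>x. norm x > R \<Longrightarrow> \<phi> x = 0"
    using test_fun_bounded_support[OF assms] by blast
  have "compact (\<phi> ` cball 0 R)"
    using assms by (intro compact_continuous_image smooth_fun_continuous) (auto simp: test_fun_smooth)
  then obtain B where B: "\<And>x. x \<in> cball 0 R \<Longrightarrow> norm (\<phi> x) \<le> B"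
    by (metis bounded_iff compact_imp_bounded image_eqI)
  have "norm (\<phi> x) \<le> max B 1" for x
    using B[of x] R(2)[of x] by (cases "norm x > R") auto
  then show ?thesis
    using that[of "max B 1"] by auto
qed

lemma test_fun_in_schwartz: "test_fun \<subseteq> schwartz"
proof
  fix \<phi> :: "'a \<Rightarrow> complex"
  assume \<phi>: "\<phi> \<in> test_fun"
  have "bounded (range (\<lambda>x. (1 + norm x) ^ m *\<^sub>R partial_derivs bs \<phi> x))" if "bs \<in> lists Basis" for m bs
  proof -
    have t: "partial_derivs bs \<phi> \<in> test_fun" 
      using \<phi> that by (rule test_fun_partial_derivs)
    obtain R where R: "R > 0" "\<And>x. norm x > R \<Longrightarrow> partial_derivs bs \<phi> x = 0"
      using test_fun_bounded_support[OF t] by blast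
    obtain B where B: "B > 0" "\<And>x. norm (partial_derivs bs \<phi> x) \<le> B"
      using test_fun_bounded[OF t] by blast
    have "norm ((1 + norm x) ^ m *\<^sub>R partial_derivs bs \<phi> x) \<le> (1 + R) ^ m * B" for x
    proof (cases "norm x > R")
      case True
      then show ?thesis using R B by simp
    next
      case False
      then show ?thesis
        using B(1) B(2)[of x] R(1) by (auto intro!: mult_mono power_mono)
    qed
    then show ?thesis
      unfolding bounded_iff by blast
  qed
  with \<phi> show "\<phi> \<in> schwartz"
    by (simp add: schwartz_def test_fun_smooth)
qed

section \<open>Integration over Euclidean space\<close>

text \<open>Translations and dilations are treated together throughout, as affine substitutions
  \<open>x \<mapsto> c x + a\<close>.\<close>

lemma lborel_integral_affine:
  fixes f :: "'a::euclidean_space \<Rightarrow> 'b::{banach, second_countable_topology}"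
  assumes "c \<noteq> 0" and [measurable]: "f \<in> borel_measurable borel"
  shows "integrable lborel (\<lambda>x. f (c *\<^sub>R x + a)) \<longleftrightarrow> integrable lborel f"
    and "integral\<^sup>L lborel f = \<bar>c\<bar> ^ DIM('a) *\<^sub>R (LINT x|lborel. f (c *\<^sub>R x + a))"
proof -
  let ?D = "density (distr lborel borel (\<lambda>x. a + c *\<^sub>R x)) (\<lambda>_. ennreal (\<bar>c\<bar> ^ DIM('a)))"
  have D: "(lborel :: 'a measure) = ?D"
    using lborel_affine[OF assms(1), of a] by simp
  have pos: "\<bar>c\<bar> ^ DIM('a) \<noteq> 0" using assms(1) by simp
  have "integrable lborel f \<longleftrightarrow> integrable ?D f"
    using D by simp
  also have "\<dots> \<longleftrightarrow> integrable (distr lborel borel (\<lambda>x. a + c *\<^sub>R x)) (\<lambda>x. (\<bar>c\<bar> ^ DIM('a)) *\<^sub>R f x)"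
    by (rule integrable_density) auto
  also have "\<dots> \<longleftrightarrow> integrable lborel (\<lambda>x. f (c *\<^sub>R x + a))"
  proof
    assume "integrable (distr lborel borel (\<lambda>x. a + c *\<^sub>R x)) (\<lambda>x. (\<bar>c\<bar> ^ DIM('a)) *\<^sub>R f x)"
    from integrable_scaleR_right[OF this, of "1 / \<bar>c\<bar> ^ DIM('a)"] pos
    show "integrable lborel (\<lambda>x. f (c *\<^sub>R x + a))"
      by (simp add: integrable_distr_eq add.commute)
  next
    assume "integrable lborel (\<lambda>x. f (c *\<^sub>R x + a))"
    then show "integrable (distr lborel borel (\<lambda>x. a + c *\<^sub>R x)) (\<lambda>x. (\<bar>c\<bar> ^ DIM('a)) *\<^sub>R f x)"
      by (intro integrable_scaleR_right) (simp add: integrable_distr_eq add.commute)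
  qed
  finally show "integrable lborel (\<lambda>x. f (c *\<^sub>R x + a)) \<longleftrightarrow> integrable lborel f" by simp
  have "integral\<^sup>L lborel f = integral\<^sup>L ?D f"
    using D by simp
  also have "\<dots> = (LINT x|distr lborel borel (\<lambda>x. a + c *\<^sub>R x). (\<bar>c\<bar> ^ DIM('a)) *\<^sub>R f x)"
    by (rule integral_density) auto
  also have "\<dots> = \<bar>c\<bar> ^ DIM('a) *\<^sub>R (LINT x|lborel. f (c *\<^sub>R x + a))"
    by (subst integral_distr) (auto simp: add.commute)
  finally show "integral\<^sup>L lborel f = \<bar>c\<bar> ^ DIM('a) *\<^sub>R (LINT x|lborel. f (c *\<^sub>R x + a))" .
qed

lemma lborel_prod_integral:
  fixes f :: "'a::euclidean_space \<Rightarrow> real \<Rightarrow> 'b::{real_normed_field, banach, second_countable_topology}"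
  assumes f: "\<And>b. b \<in> Basis \<Longrightarrow> integrable lborel (f b)"
  shows "integrable lborel (\<lambda>x::'a. \<Prod>b\<in>Basis. f b (x \<bullet> b))"
    and "(LINT x|lborel. (\<Prod>b\<in>Basis. f b (x \<bullet> b))) = (\<Prod>b\<in>Basis. integral\<^sup>L lborel (f b))"
proof -
  interpret product_sigma_finite "\<lambda>_::'a. lborel :: real measure" ..
  let ?T = "\<lambda>g. \<Sum>b\<in>Basis. g b *\<^sub>R (b::'a)"
  let ?P = "\<Pi>\<^sub>M b\<in>(Basis::'a set). (lborel :: real measure)"
  have [measurable]: "f b \<in> borel_measurable borel" if "b \<in> Basis" for b
    using borel_measurable_integrable[OF f[OF that]] by simp
  have T[measurable]: "?T \<in> measurable ?P borel"
    by measurable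
  have m: "(\<lambda>x::'a. \<Prod>b\<in>Basis. f b (x \<bullet> b)) \<in> borel_measurable borel"
    by measurable
  have "integrable ?P (\<lambda>x. \<Prod>b\<in>Basis. f b (x b))"
    by (rule product_integrable_prod) (auto intro: f)
  then have "integrable (distr ?P borel ?T) (\<lambda>x::'a. \<Prod>b\<in>Basis. f b (x \<bullet> b))"
    by (subst integrable_distr_eq[OF T m]) simp
  then show "integrable lborel (\<lambda>x::'a. \<Prod>b\<in>Basis. f b (x \<bullet> b))"
    by (simp only: lborel_eq[symmetric])
  have "(LINT x|lborel. (\<Prod>b\<in>Basis. f b (x \<bullet> b))) = (LINT x|distr ?P borel ?T. (\<Prod>b\<in>Basis. f b (x \<bullet> b)))"
    by (simp only: lborel_eq[symmetric])
  also have "\<dots> = (LINT x|?P. (\<Prod>b\<in>Basis. f b (x b)))"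
    by (subst integral_distr[OF T m]) simp
  also have "\<dots> = (\<Prod>b\<in>Basis. integral\<^sup>L lborel (f b))"
    by (rule product_integral_prod) (auto intro: f)
  finally show "(LINT x|lborel. (\<Prod>b\<in>Basis. f b (x \<bullet> b))) = (\<Prod>b\<in>Basis. integral\<^sup>L lborel (f b))" .
qed

text \<open>The function is dominated by the product of \<open>1 / (1 + u\<^sup>2)\<close> over the coordinates \<open>u\<close>.\<close>

lemma integrable_inverse_power_norm:
  "integrable lborel (\<lambda>x::'a::euclidean_space. 1 / (1 + norm x) ^ (2 * DIM('a)))"
proof (rule Bochner_Integration.integrable_bound)
  have "integrable lborel (\<lambda>u::real. inverse (1 + u\<^sup>2))"
    using integrable_inverse_1_plus_square by (simp add: set_integrable_def einterval_def)
  then show "integrable lborel (\<lambda>x::'a. \<Prod>b\<in>Basis. inverse (1 + (x \<bullet> b)\<^sup>2))"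
    by (rule lborel_prod_integral(1))
  have "1 / (1 + norm x) ^ (2 * DIM('a)) \<le> (\<Prod>b\<in>Basis. inverse (1 + (x \<bullet> b)\<^sup>2))" for x :: 'a
  proof -
    have "1 + (x \<bullet> b)\<^sup>2 \<le> (1 + norm x)\<^sup>2" if "b \<in> Basis" for b
    proof -
      have "(x \<bullet> b)\<^sup>2 \<le> (norm x)\<^sup>2"
        using Basis_le_norm[OF that, of x] by (metis abs_le_square_iff abs_norm_cancel)
      then show ?thesis
        by (simp add: power2_sum add_increasing2)
    qed
    then have "inverse ((1 + norm x)\<^sup>2) \<le> inverse (1 + (x \<bullet> b)\<^sup>2)" if "b \<in> Basis" for b
      by (rule le_imp_inverse_le) (use that in \<open>auto intro!: add_pos_nonneg\<close>)
    then have "(\<Prod>b\<in>(Basis::'a set). inverse ((1 + norm x)\<^sup>2)) \<le> (\<Prod>b\<in>Basis. inverse (1 + (x \<bullet> b)\<^sup>2))"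
      by (intro prod_mono) auto
    then show ?thesis
      by (simp add: power_mult power_inverse inverse_eq_divide power_divide)
  qed
  moreover have "norm (1 / (1 + norm x) ^ (2 * DIM('a))) = 1 / (1 + norm x) ^ (2 * DIM('a))" for x :: 'a
    by simp
  ultimately have "norm (1 / (1 + norm x) ^ (2 * DIM('a))) \<le> norm (\<Prod>b\<in>Basis. inverse (1 + (x \<bullet> b)\<^sup>2))" for x :: 'a
    by (metis abs_ge_self order_trans real_norm_def)
  then show "AE x in lborel. norm (1 / (1 + norm (x::'a)) ^ (2 * DIM('a)))
      \<le> norm (\<Prod>b\<in>Basis. inverse (1 + (x \<bullet> b)\<^sup>2))" 
    by (intro AE_I2)
qed simp

section \<open>Schwartz functions\<close>

lemma smooth_fun_measurable: "smooth_fun f \<Longrightarrow> f \<in> borel_measurable borel"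
  by (intro borel_measurable_continuous_onI smooth_fun_continuous)

lemma schwartz_smooth: "\<phi> \<in> schwartz \<Longrightarrow> smooth_fun \<phi>"
  by (simp add: schwartz_def)

lemma schwartzI:
  assumes "smooth_fun \<phi>"
    and "\<And>bs m. bs \<in> lists Basis \<Longrightarrow> \<exists>B. \<forall>x. (1 + norm x) ^ m * cmod (partial_derivs bs \<phi> x) \<le> B"
  shows "\<phi> \<in> schwartz"
  using assms unfolding schwartz_def bounded_iff by auto

lemma schwartz_bound:
  fixes m :: nat
  assumes "\<phi> \<in> schwartz" "bs \<in> lists Basis"
  obtains B where "\<And>x. (1 + norm x) ^ m * cmod (partial_derivs bs \<phi> x) \<le> B"
proof -
  have "bounded (range (\<lambda>x. (1 + norm x) ^ m *\<^sub>R partial_derivs bs \<phi> x))"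
    using assms unfolding schwartz_def by blast
  then show ?thesis
    using that unfolding bounded_iff by auto
qed

lemma schwartz_integrable:
  fixes \<phi> :: "'a::euclidean_space \<Rightarrow> complex"
  assumes "\<phi> \<in> schwartz"
  shows "integrable lborel \<phi>"
proof -
  obtain B where B: "\<And>x. (1 + norm x) ^ (2 * DIM('a)) * cmod (partial_derivs [] \<phi> x) \<le> B"
    using schwartz_bound[OF assms lists.Nil] by blast
  show ?thesis
  proof (rule Bochner_Integration.integrable_bound)
    show "integrable lborel (\<lambda>x::'a. B * (1 / (1 + norm x) ^ (2 * DIM('a))))"
      by (intro integrable_mult_right integrable_inverse_power_norm)
    have "0 < (1 + norm x) ^ (2 * DIM('a))" for x :: 'a
      by (intro zero_less_power add_pos_nonneg) auto
    then have "cmod (\<phi> x) \<le> B * (1 / (1 + norm x) ^ (2 * DIM('a)))" for x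
      using B[of x] by (simp add: field_simps)
    then have "norm (\<phi> x) \<le> norm (B * (1 / (1 + norm x) ^ (2 * DIM('a))))" for x
      using order_trans[OF _ abs_ge_self] by (metis real_norm_def)
    then show "AE x in lborel. norm (\<phi> x) \<le> norm (B * (1 / (1 + norm x) ^ (2 * DIM('a))))"
      by (intro AE_I2)
  qed (use assms in \<open>simp add: smooth_fun_measurable schwartz_smooth\<close>)
qed

lemma schwartz_add:
  assumes "\<phi> \<in> schwartz" "\<psi> \<in> schwartz"
  shows "(\<lambda>x. \<phi> x + \<psi> x) \<in> schwartz"
proof (rule schwartzI)
  fix bs :: "'a list" and m :: nat
  assume bs: "bs \<in> lists Basis"
  obtain B1 where B1: "\<And>x. (1 + norm x) ^ m * cmod (partial_derivs bs \<phi> x) \<le> B1"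
    using schwartz_bound[OF assms(1) bs] by blast
  obtain B2 where B2: "\<And>x. (1 + norm x) ^ m * cmod (partial_derivs bs \<psi> x) \<le> B2"
    using schwartz_bound[OF assms(2) bs] by blast
  have "(1 + norm x) ^ m * cmod (partial_derivs bs \<phi> x + partial_derivs bs \<psi> x) \<le> B1 + B2" for x
  proof -
    have "(1 + norm x) ^ m * cmod (partial_derivs bs \<phi> x + partial_derivs bs \<psi> x)
       \<le> (1 + norm x) ^ m * (cmod (partial_derivs bs \<phi> x) + cmod (partial_derivs bs \<psi> x))"
      by (intro mult_left_mono norm_triangle_ineq) auto
    then show ?thesis
      using B1[of x] B2[of x] by (simp add: distrib_left)
  qed
  then show "\<exists>B. \<forall>x. (1 + norm x) ^ m * cmod (partial_derivs bs (\<lambda>x. \<phi> x + \<psi> x) x) \<le> B"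
    using assms bs by (auto simp: partial_derivs_add schwartz_smooth)
qed (use assms in \<open>simp add: smooth_fun_add schwartz_smooth\<close>)

lemma schwartz_cmult:
  assumes "\<phi> \<in> schwartz"
  shows "(\<lambda>x. c * \<phi> x) \<in> schwartz"
proof (rule schwartzI)
  fix bs :: "'a list" and m :: nat
  assume bs: "bs \<in> lists Basis"
  obtain B where B: "\<And>x. (1 + norm x) ^ m * cmod (partial_derivs bs \<phi> x) \<le> B"
    using schwartz_bound[OF assms bs] by blast
  have "(1 + norm x) ^ m * cmod (c * partial_derivs bs \<phi> x) \<le> cmod c * B" for x
    using mult_left_mono[OF B[of x], of "cmod c"] by (simp add: norm_mult mult_ac)
  then show "\<exists>B. \<forall>x. (1 + norm x) ^ m * cmod (partial_derivs bs (\<lambda>x. c * \<phi> x) x) \<le> B"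
    using assms bs by (auto simp: partial_derivs_cmult schwartz_smooth)
qed (use assms in \<open>simp add: smooth_fun_cmult schwartz_smooth\<close>)

text \<open>An affine substitution changes the polynomial weight only up to a constant factor. Hence it acts
  continuously on the Schwartz space and on the Sobolev spaces.\<close>

lemma weight_affine:
  fixes a :: "'a::euclidean_space"
  assumes "c \<noteq> 0"
  obtains K where "K > 0" "\<And>x. 1 + norm x \<le> K * (1 + norm (c *\<^sub>R x + a))"
proof
  show "1 + (1 + norm a) / \<bar>c\<bar> > 0"
    by (intro add_pos_nonneg) auto
  fix x :: 'a
  have "\<bar>c\<bar> * norm x \<le> norm (c *\<^sub>R x + a) + norm a"
    using norm_triangle_ineq4[of "c *\<^sub>R x + a" a] by simp
  then have "norm x \<le> (norm (c *\<^sub>R x + a) + norm a) / \<bar>c\<bar>"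
    using assms by (simp add: field_simps)
  also have "1 + (norm (c *\<^sub>R x + a) + norm a) / \<bar>c\<bar> \<le> (1 + (1 + norm a) / \<bar>c\<bar>) * (1 + norm (c *\<^sub>R x + a))"
    using assms by (simp add: field_simps)
  finally show "1 + norm x \<le> (1 + (1 + norm a) / \<bar>c\<bar>) * (1 + norm (c *\<^sub>R x + a))"
    by simp
qed

lemma schwartz_affine:
  assumes "\<phi> \<in> schwartz" "c \<noteq> 0"
  shows "(\<lambda>x. \<phi> (c *\<^sub>R x + a)) \<in> schwartz"
proof (rule schwartzI)
  fix bs :: "'a list" and m :: nat
  assume bs: "bs \<in> lists Basis"
  obtain B where B: "\<And>x. (1 + norm x) ^ m * cmod (partial_derivs bs \<phi> x) \<le> B"
    using schwartz_bound[OF assms(1) bs] by blast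
  obtain K where K: "K > 0" "\<And>x. 1 + norm x \<le> K * (1 + norm (c *\<^sub>R x + a))"
    using weight_affine[OF assms(2)] by blast
  have "(1 + norm x) ^ m * cmod (partial_derivs bs (\<lambda>x. \<phi> (c *\<^sub>R x + a)) x) \<le> \<bar>c\<bar> ^ length bs * (K ^ m * B)" for x
  proof -
    have "(1 + norm x) ^ m * cmod (partial_derivs bs \<phi> (c *\<^sub>R x + a))
        \<le> (K * (1 + norm (c *\<^sub>R x + a))) ^ m * cmod (partial_derivs bs \<phi> (c *\<^sub>R x + a))"
      by (intro mult_right_mono power_mono K) auto
    also have "\<dots> \<le> K ^ m * B"
      using mult_left_mono[OF B[of "c *\<^sub>R x + a"], of "K ^ m"] K(1) by (simp add: power_mult_distrib mult_ac)
    finally show ?thesis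
      using mult_left_mono[of "(1 + norm x) ^ m * cmod (partial_derivs bs \<phi> (c *\<^sub>R x + a))" "K ^ m * B" "\<bar>c\<bar> ^ length bs"] assms bs 
      by (simp add: partial_derivs_affine schwartz_smooth norm_mult norm_power mult_ac)
  qed
  then show "\<exists>B. \<forall>x. (1 + norm x) ^ m * cmod (partial_derivs bs (\<lambda>x. \<phi> (c *\<^sub>R x + a)) x) \<le> B"
    by blast
qed (use assms in \<open>simp add: smooth_fun_affine schwartz_smooth\<close>)

lemma schwartz_affine_iff:
  assumes "c \<noteq> 0"
  shows "(\<lambda>x. \<phi> (c *\<^sub>R x + a)) \<in> schwartz \<longleftrightarrow> \<phi> \<in> schwartz"
proof
  assume "(\<lambda>x. \<phi> (c *\<^sub>R x + a)) \<in> schwartz"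
  from schwartz_affine[OF this, of "1 / c" "- (1 / c) *\<^sub>R a"] assms show "\<phi> \<in> schwartz"
    by (simp add: algebra_simps)
qed (rule schwartz_affine[OF _ assms])

lemma schwartz_tendsto_affine:
  assumes "\<And>n. \<phi> n \<in> schwartz" "\<psi> \<in> schwartz" "schwartz_tendsto \<phi> \<psi>" "c \<noteq> 0"
  shows "schwartz_tendsto (\<lambda>n x. \<phi> n (c *\<^sub>R x + a)) (\<lambda>x. \<psi> (c *\<^sub>R x + a))"
  unfolding schwartz_tendsto_def
proof (intro ballI allI)
  fix bs :: "'a list" and m :: nat
  assume bs: "bs \<in> lists Basis"
  obtain K where K: "K > 0" "\<And>x. 1 + norm x \<le> K * (1 + norm (c *\<^sub>R x + a))"
    using weight_affine[OF assms(4)] by blast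
  let ?L = "\<bar>c\<bar> ^ length bs * K ^ m"
  have Lp: "?L > 0" using K(1) assms(4) by simp
  show "uniform_limit UNIV (\<lambda>n x. (1 + norm x) ^ m *\<^sub>R
          (partial_derivs bs (\<lambda>x. \<phi> n (c *\<^sub>R x + a)) x - partial_derivs bs (\<lambda>x. \<psi> (c *\<^sub>R x + a)) x))
        (\<lambda>x. 0) sequentially"
  proof (rule uniform_limitI)
    fix e :: real
    assume "e > 0"
    then have "e / ?L > 0" using Lp by (rule divide_pos_pos)
    have "uniform_limit UNIV (\<lambda>n x. (1 + norm x) ^ m *\<^sub>R (partial_derivs bs (\<phi> n) x - partial_derivs bs \<psi> x))
        (\<lambda>x. 0) sequentially"
      using bspec[OF assms(3)[unfolded schwartz_tendsto_def] bs] by blast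
    from uniform_limitD[OF this \<open>e / ?L > 0\<close>] show "\<forall>\<^sub>F n in sequentially. \<forall>x\<in>UNIV. dist ((1 + norm x) ^ m *\<^sub>R
          (partial_derivs bs (\<lambda>x. \<phi> n (c *\<^sub>R x + a)) x - partial_derivs bs (\<lambda>x. \<psi> (c *\<^sub>R x + a)) x)) 0 < e"
    proof eventually_elim
      case (elim n)
      show ?case
      proof
        fix x
        let ?y = "c *\<^sub>R x + a"
        let ?D = "partial_derivs bs (\<phi> n) ?y - partial_derivs bs \<psi> ?y"
        have 1: "partial_derivs bs (\<lambda>x. \<phi> n (c *\<^sub>R x + a)) x - partial_derivs bs (\<lambda>x. \<psi> (c *\<^sub>R x + a)) x
              = of_real (c ^ length bs) * ?D"
          using assms bs by (simp add: partial_derivs_affine schwartz_smooth right_diff_distrib)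
        have "(1 + norm ?y) ^ m * cmod ?D < e / ?L"
          using elim by auto
        then have 2: "?L * ((1 + norm ?y) ^ m * cmod ?D) < e"
          using Lp by (simp add: field_simps)
        have "(1 + norm x) ^ m * (\<bar>c\<bar> ^ length bs * cmod ?D) \<le> (K * (1 + norm ?y)) ^ m * (\<bar>c\<bar> ^ length bs * cmod ?D)"
          by (intro mult_right_mono power_mono K) auto
        also have "\<dots> = ?L * ((1 + norm ?y) ^ m * cmod ?D)"
          by (simp add: power_mult_distrib mult_ac)
        also note 2
        finally show "dist ((1 + norm x) ^ m *\<^sub>R
          (partial_derivs bs (\<lambda>x. \<phi> n (c *\<^sub>R x + a)) x - partial_derivs bs (\<lambda>x. \<psi> (c *\<^sub>R x + a)) x)) 0 < e"
          unfolding 1 by (simp add: norm_mult norm_power)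
      qed
    qed
  qed
qed

section \<open>Tempered distributions\<close>

lemma temperedI:
  assumes "\<And>\<phi> \<psi>. \<phi> \<in> schwartz \<Longrightarrow> \<psi> \<in> schwartz \<Longrightarrow> T (\<lambda>x. \<phi> x + \<psi> x) = T \<phi> + T \<psi>"
    and "\<And>c \<phi>. \<phi> \<in> schwartz \<Longrightarrow> T (\<lambda>x. c * \<phi> x) = c * T \<phi>"
    and "\<And>\<phi> \<psi>. (\<And>n. \<phi> n \<in> schwartz) \<Longrightarrow> \<psi> \<in> schwartz \<Longrightarrow> schwartz_tendsto \<phi> \<psi> \<Longrightarrow>
           (\<lambda>n. T (\<phi> n)) \<longlonglongrightarrow> T \<psi>"
    and "\<And>\<phi>. \<phi> \<notin> schwartz \<Longrightarrow> T \<phi> = 0"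
  shows "T \<in> tempered"
  unfolding tempered_def mem_Collect_eq
  by (intro conjI ballI allI impI) (blast intro: assms)+

lemma temperedD:
  assumes "T \<in> tempered"
  shows "\<phi> \<in> schwartz \<Longrightarrow> \<psi> \<in> schwartz \<Longrightarrow> T (\<lambda>x. \<phi> x + \<psi> x) = T \<phi> + T \<psi>"
    and "\<phi> \<in> schwartz \<Longrightarrow> T (\<lambda>x. c * \<phi> x) = c * T \<phi>"
    and "(\<And>n. f n \<in> schwartz) \<Longrightarrow> \<psi> \<in> schwartz \<Longrightarrow> schwartz_tendsto f \<psi> \<Longrightarrow> (\<lambda>n. T (f n)) \<longlonglongrightarrow> T \<psi>"
    and "\<phi> \<notin> schwartz \<Longrightarrow> T \<phi> = 0"
  using assms unfolding tempered_def mem_Collect_eq by simp_all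

lemma tempered_affine:
  assumes T: "T \<in> tempered" and c: "c \<noteq> 0"
  shows "(\<lambda>\<phi>. k * T (\<lambda>x. \<phi> (c *\<^sub>R x + a))) \<in> tempered"
proof (rule temperedI)
  show "(\<lambda>n. k * T (\<lambda>x. \<phi> n (c *\<^sub>R x + a))) \<longlonglongrightarrow> k * T (\<lambda>x. \<psi> (c *\<^sub>R x + a))"
    if "\<And>n. \<phi> n \<in> schwartz" "\<psi> \<in> schwartz" "schwartz_tendsto \<phi> \<psi>" for \<phi> \<psi>
    by (intro tendsto_mult_left temperedD(3)[OF T] schwartz_affine schwartz_tendsto_affine that c)
  show "k * T (\<lambda>x. \<phi> (c *\<^sub>R x + a) + \<psi> (c *\<^sub>R x + a))
      = k * T (\<lambda>x. \<phi> (c *\<^sub>R x + a)) + k * T (\<lambda>x. \<psi> (c *\<^sub>R x + a))"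
    if "\<phi> \<in> schwartz" "\<psi> \<in> schwartz" for \<phi> \<psi>
    using temperedD(1)[OF T schwartz_affine[OF that(1) c, of a] schwartz_affine[OF that(2) c, of a]]
    by (simp add: distrib_left)
  show "k * T (\<lambda>x. d * \<phi> (c *\<^sub>R x + a)) = d * (k * T (\<lambda>x. \<phi> (c *\<^sub>R x + a)))" if "\<phi> \<in> schwartz" for \<phi> d
    using temperedD(2)[OF T schwartz_affine[OF that(1) c, of a], of d] by simp
  show "k * T (\<lambda>x. \<phi> (c *\<^sub>R x + a)) = 0" if "\<phi> \<notin> schwartz" for \<phi>
    using temperedD(4)[OF T] that schwartz_affine_iff[OF c, of \<phi> a] by simp
qed

lemma tempered_linear:
  assumes "S \<in> tempered" "T \<in> tempered"
  shows "(\<lambda>\<phi>. a * S \<phi> + b * T \<phi>) \<in> tempered"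
proof (rule temperedI)
  show "(\<lambda>n. a * S (\<phi> n) + b * T (\<phi> n)) \<longlonglongrightarrow> a * S \<psi> + b * T \<psi>"
    if "\<And>n. \<phi> n \<in> schwartz" "\<psi> \<in> schwartz" "schwartz_tendsto \<phi> \<psi>" for \<phi> \<psi>
    by (intro tendsto_add tendsto_mult_left temperedD(3)[OF assms(1)] temperedD(3)[OF assms(2)] that)
qed (simp_all add: temperedD[OF assms(1)] temperedD[OF assms(2)] algebra_simps)

text \<open>Convergence in the Schwartz space with weight of degree \<open>2 * DIM('a)\<close> implies convergence in
  \<open>L\<^sub>1\<close>, which is enough against a bounded function.\<close>

lemma tempered_of_bounded_fun:
  fixes F :: "'a::euclidean_space \<Rightarrow> complex"
  assumes [measurable]: "F \<in> borel_measurable borel" and M: "\<And>x. cmod (F x) \<le> M"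
  shows "(\<lambda>\<phi>. if \<phi> \<in> schwartz then LINT x|lborel. F x * \<phi> x else 0) \<in> tempered"
proof -
  let ?T = "\<lambda>\<phi>. if \<phi> \<in> schwartz then LINT x|lborel. F x * \<phi> x else 0"
  have M0: "M \<ge> 0" using order_trans[OF norm_ge_zero M] .
  have int: "integrable lborel (\<lambda>x. F x * \<phi> x)" if "\<phi> \<in> schwartz" for \<phi>
  proof (rule Bochner_Integration.integrable_bound)
    show "integrable lborel (\<lambda>x. M * cmod (\<phi> x))"
      using schwartz_integrable[OF that] by simp
    show "(\<lambda>x. F x * \<phi> x) \<in> borel_measurable lborel"
      using that by (auto intro!: borel_measurable_times simp: schwartz_smooth smooth_fun_measurable)
    show "AE x in lborel. norm (F x * \<phi> x) \<le> norm (M * cmod (\<phi> x))"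
      using M M0 by (auto simp: norm_mult intro!: mult_right_mono)
  qed
  define I where "I = (LINT x|lborel. 1 / (1 + norm (x::'a)) ^ (2 * DIM('a)))"
  have I0: "I \<ge> 0" unfolding I_def by (rule integral_nonneg_AE) auto
  have "(\<lambda>n. ?T (\<phi> n)) \<longlonglongrightarrow> ?T \<psi>"
    if \<phi>: "\<And>n. \<phi> n \<in> schwartz" and \<psi>: "\<psi> \<in> schwartz" and lim: "schwartz_tendsto \<phi> \<psi>" for \<phi> \<psi>
  proof (rule tendstoI)
    fix e :: real
    assume e: "e > 0"
    let ?d = "e / (1 + M * I)"
    have MI: "1 + M * I > 0" using M0 I0 by (simp add: add_pos_nonneg)
    then have "?d > 0" using e by simp
    have "uniform_limit UNIV (\<lambda>n x. (1 + norm x) ^ (2 * DIM('a)) *\<^sub>R (partial_derivs [] (\<phi> n) x - partial_derivs [] \<psi> x))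
          (\<lambda>x. 0) sequentially"
      using bspec[OF lim[unfolded schwartz_tendsto_def] lists.Nil] by blast
    from uniform_limitD[OF this \<open>?d > 0\<close>]
    show "\<forall>\<^sub>F n in sequentially. dist (?T (\<phi> n)) (?T \<psi>) < e"
    proof eventually_elim
      case (elim n)
      have w: "(1 + norm x) ^ (2 * DIM('a)) > 0" for x :: 'a
        by (intro zero_less_power add_pos_nonneg) auto
      have pt: "cmod (F x * \<phi> n x - F x * \<psi> x) \<le> M * ?d * (1 / (1 + norm x) ^ (2 * DIM('a)))" for x
      proof -
        have "(1 + norm x) ^ (2 * DIM('a)) * cmod (\<phi> n x - \<psi> x) < ?d"
          using elim[rule_format, of x] by simp
        then have "cmod (\<phi> n x - \<psi> x) \<le> ?d / (1 + norm x) ^ (2 * DIM('a))"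
          by (subst pos_le_divide_eq[OF w]) (simp only: mult.commute less_imp_le)
        then have "cmod (\<phi> n x - \<psi> x) \<le> ?d * (1 / (1 + norm x) ^ (2 * DIM('a)))"
          by simp
        then have "cmod (F x) * cmod (\<phi> n x - \<psi> x) \<le> M * (?d * (1 / (1 + norm x) ^ (2 * DIM('a))))"
          by (intro mult_mono M M0) auto
        then show ?thesis
          by (simp add: norm_mult[symmetric] algebra_simps)
      qed
      have "?T (\<phi> n) - ?T \<psi> = (LINT x|lborel. F x * \<phi> n x - F x * \<psi> x)"
        using \<phi> \<psi> by (simp add: Bochner_Integration.integral_diff int)
      also have "cmod \<dots> \<le> (LINT x|lborel. cmod (F x * \<phi> n x - F x * \<psi> x))"
        by (rule integral_norm_bound)
      also have "\<dots> \<le> (LINT x|lborel. M * ?d * (1 / (1 + norm (x::'a)) ^ (2 * DIM('a))))"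
        using int[OF \<phi>] int[OF \<psi>] pt
        by (intro integral_mono integrable_norm Bochner_Integration.integrable_diff 
            integrable_mult_right integrable_inverse_power_norm) auto
      also have "\<dots> = M * ?d * I"
        unfolding I_def by (rule integral_mult_right_zero)
      also have "\<dots> < e"
        using e MI M0 I0 by (simp add: field_simps)
      finally show ?case
        by (simp add: dist_norm)
    qed
  qed
  then show ?thesis
    by (intro temperedI)
      (auto simp: schwartz_add schwartz_cmult distrib_left int mult.left_commute[of "F _"])
qed

section \<open>The fundamental lemma of the calculus of variations\<close>

lemma locally_L2_set_integrable:
  fixes g :: "'a::euclidean_space \<Rightarrow> complex"
  assumes "locally_L2 g" "compact K"
  shows "set_integrable lborel K g"
  unfolding set_integrable_def
proof (rule Bochner_Integration.integrable_bound)
  have K: "K \<in> sets borel" "emeasure lborel K < \<infinity>"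
    using assms(2) emeasure_compact_finite by (auto simp: compact_imp_closed borel_closed)
  have "integrable lborel (\<lambda>x. indicator K x *\<^sub>R (cmod (g x))\<^sup>2)"
    using assms unfolding locally_L2_def set_integrable_def by blast
  moreover have "integrable lborel (\<lambda>x. indicator K x :: real)"
    using K by simp
  ultimately show "integrable lborel (\<lambda>x. indicator K x + indicator K x *\<^sub>R (cmod (g x))\<^sup>2)"
    by (rule Bochner_Integration.integrable_add[rotated])
  show "(\<lambda>x. indicator K x *\<^sub>R g x) \<in> borel_measurable lborel"
    using assms(1) K(1) unfolding locally_L2_def by (intro borel_measurable_scaleR) simp_all
  have "t \<le> 1 + t\<^sup>2" for t :: real
    using sum_squares_bound[of t 1] by (simp add: power2_eq_square) (smt (verit) zero_le_square)
  then show "AE x in lborel. norm (indicator K x *\<^sub>R g x)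
      \<le> norm (indicator K x + indicator K x *\<^sub>R (cmod (g x))\<^sup>2)"
    by (auto simp: indicator_def)
qed

lemma locally_L2_test_integrable:
  fixes g :: "'a::euclidean_space \<Rightarrow> complex"
  assumes g: "locally_L2 g" and \<phi>: "\<phi> \<in> test_fun"
  shows "integrable lborel (\<lambda>x. g x * \<phi> x)"
proof -
  obtain R where R: "R > 0" "\<And>x. norm x > R \<Longrightarrow> \<phi> x = 0"
    using test_fun_bounded_support[OF \<phi>] by blast
  obtain B where B: "B > 0" "\<And>x. norm (\<phi> x) \<le> B"
    using test_fun_bounded[OF \<phi>] by blast
  show ?thesis
  proof (rule Bochner_Integration.integrable_bound)
  show "integrable lborel (\<lambda>x. B *\<^sub>R (indicator (cball 0 R) x *\<^sub>R g x))"
    using locally_L2_set_integrable[OF g compact_cball, of 0 R]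
    unfolding set_integrable_def by (rule integrable_scaleR_right)
  show "(\<lambda>x. g x * \<phi> x) \<in> borel_measurable lborel"
    using g smooth_fun_measurable[OF test_fun_smooth[OF \<phi>]]
      by (intro borel_measurable_times) (simp_all add: locally_L2_def)
  show "AE x in lborel. norm (g x * \<phi> x) \<le> norm (B *\<^sub>R (indicator (cball 0 R) x *\<^sub>R g x))"
    using R B(1) by (auto simp: indicator_def norm_mult not_le mult.commute[of B] intro!: mult_left_mono B(2))
  qed
qed

lemma flat_exp_one_bounds: "0 \<le> flat_exp 1 u" "flat_exp 1 u \<le> 1"
  by (auto simp: flat_exp_def)

text \<open>Rescaling the argument makes the smooth step \<open>flat_exp 1\<close> approach the indicator function of
  the open half line; this turns bump functions into approximations of indicator functions.\<close>

lemma flat_exp_scaled_tendsto: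
  assumes "u > 0"
  shows "(\<lambda>n. flat_exp 1 (real (Suc n) * u)) \<longlonglongrightarrow> 1"
proof -
  have "(\<lambda>n. exp (- (1 / u) * inverse (real (Suc n)))) \<longlonglongrightarrow> exp (- (1 / u) * 0)"
    by (intro tendsto_intros LIMSEQ_inverse_real_of_nat)
  then show ?thesis
    using assms by (simp add: flat_exp_def divide_inverse mult_ac)
qed

text \<open>In each coordinate one smooth step opens the interval and a reflected one closes it.\<close>

lemma box_bump:
  fixes a b :: "'a::euclidean_space"
  obtains \<phi> :: "nat \<Rightarrow> 'a \<Rightarrow> complex"
  where "\<And>n. \<phi> n \<in> test_fun" "\<And>n x. cmod (\<phi> n x) \<le> indicator (box a b) x"
    and "\<And>x. (\<lambda>n. \<phi> n x) \<longlonglongrightarrow> indicator (box a b) x"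
proof
  let ?l = "\<lambda>n e x. flat_exp 1 (real (Suc n) * (x \<bullet> e - a \<bullet> e))"
  let ?r = "\<lambda>n e x. flat_exp 1 (real (Suc n) * (b \<bullet> e - x \<bullet> e))"
  define \<phi> where "\<phi> n x = (\<Prod>e\<in>Basis. complex_of_real (?l n e x) * complex_of_real (?r n e x))" for n x
  have zero: "\<phi> n x = 0" if x: "x \<notin> box a b" for n x
  proof -
    obtain e where e: "e \<in> Basis" "x \<bullet> e \<le> a \<bullet> e \<or> b \<bullet> e \<le> x \<bullet> e"
      using x unfolding mem_box by (metis not_le)
    then have "?l n e x * ?r n e x = 0"
      by (auto simp: flat_exp_def zero_less_mult_iff)
    then have "complex_of_real (?l n e x) * complex_of_real (?r n e x) = 0"
      by (metis of_real_0 of_real_mult)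
    then show ?thesis
      unfolding \<phi>_def using e(1) by (intro prod_zero) auto
  qed
  have "smooth_fun (\<phi> n)" for n
  proof -
    have "smooth_fun (\<lambda>x. complex_of_real (?l n e x) * complex_of_real (?r n e x))" for e
      using smooth_fun_mult[OF smooth_fun_flat[of 1 "real (Suc n) *\<^sub>R e" "real (Suc n) * (a \<bullet> e)"]
          smooth_fun_flat[of 1 "- (real (Suc n) *\<^sub>R e)" "- (real (Suc n) * (b \<bullet> e))"]]
      by (simp add: right_diff_distrib)
    then show ?thesis
      unfolding \<phi>_def by (intro smooth_fun_prod) auto
  qed
  moreover have "{x. \<phi> n x \<noteq> 0} \<subseteq> box a b" for n
    using zero by auto
  ultimately show "\<phi> n \<in> test_fun" for n
    unfolding test_fun_def using bounded_box bounded_subset by blast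
  show "cmod (\<phi> n x) \<le> indicator (box a b) x" for n x
  proof (cases "x \<in> box a b")
    case True
    have "cmod (\<phi> n x) = (\<Prod>e\<in>Basis. ?l n e x * ?r n e x)"
      unfolding \<phi>_def by (simp add: prod_norm[symmetric] norm_mult flat_exp_one_bounds)
    also have "\<dots> \<le> 1"
      by (intro prod_le_1) (auto intro!: mult_le_one flat_exp_one_bounds mult_nonneg_nonneg)
    finally show ?thesis using True by simp
  qed (simp add: zero)
  show "(\<lambda>n. \<phi> n x) \<longlonglongrightarrow> indicator (box a b) x" for x
  proof (cases "x \<in> box a b")
    case True
    have "(\<lambda>n. \<phi> n x) \<longlonglongrightarrow> (\<Prod>e\<in>(Basis::'a set). complex_of_real 1 * complex_of_real 1)"
      unfolding \<phi>_def
      by (intro tendsto_prod tendsto_mult tendsto_of_real flat_exp_scaled_tendsto)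
        (use True in \<open>auto simp: mem_box\<close>)
    then show ?thesis using True by simp
  qed (simp add: zero)
qed

text \<open>Bump functions give vanishing integrals of \<open>g\<close> over boxes, these form an intersection-stable
  generator of the Borel sets, and countably many boxes exhaust the space. This makes the function
  that represents a Fourier transform unique up to null sets.\<close>

lemma fundamental_lemma:
  fixes g :: "'a::euclidean_space \<Rightarrow> complex"
  assumes g: "locally_L2 g" and orth: "\<And>\<phi>. \<phi> \<in> test_fun \<Longrightarrow> (LINT x|lborel. g x * \<phi> x) = 0"
  shows "AE x in lborel. g x = 0"
proof -
  have [measurable]: "g \<in> borel_measurable borel"
    using g by (simp add: locally_L2_def)
  have int: "integrable lborel (\<lambda>x. indicator (box a b) x *\<^sub>R g x)" for a b
  proof (rule Bochner_Integration.integrable_bound)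
    show "integrable lborel (\<lambda>x. indicator (cbox a b) x *\<^sub>R g x)"
      using locally_L2_set_integrable[OF g compact_cbox] unfolding set_integrable_def .
    show "AE x in lborel. norm (indicator (box a b) x *\<^sub>R g x) \<le> norm (indicator (cbox a b) x *\<^sub>R g x)"
      using box_subset_cbox by (auto simp: indicator_def)
  qed measurable
  have box0: "(LINT x|lborel. indicator (box a b) x *\<^sub>R g x) = 0" for a b
  proof -
    obtain \<phi> :: "nat \<Rightarrow> 'a \<Rightarrow> complex" where \<phi>: "\<And>n. \<phi> n \<in> test_fun"
      "\<And>n x. cmod (\<phi> n x) \<le> indicator (box a b) x"
      "\<And>x. (\<lambda>n. \<phi> n x) \<longlonglongrightarrow> indicator (box a b) x"
      using box_bump[of a b] by blast
    have "(\<lambda>n. LINT x|lborel. g x * \<phi> n x) \<longlonglongrightarrow> (LINT x|lborel. g x * indicator (box a b) x)"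
    proof (rule integral_dominated_convergence)
      show "integrable lborel (\<lambda>x. norm (indicator (box a b) x *\<^sub>R g x))"
        by (rule integrable_norm[OF int])
      show "AE x in lborel. (\<lambda>n. g x * \<phi> n x) \<longlonglongrightarrow> g x * indicator (box a b) x"
        by (intro AE_I2 tendsto_intros \<phi>)
      show "AE x in lborel. norm (g x * \<phi> n x) \<le> norm (indicator (box a b) x *\<^sub>R g x)" for n
      proof (rule AE_I2)
        fix x
        show "norm (g x * \<phi> n x) \<le> norm (indicator (box a b) x *\<^sub>R g x)"
          using mult_left_mono[OF \<phi>(2)[of n x] norm_ge_zero[of "g x"]] by (simp add: norm_mult mult.commute)
      qed
      show "(\<lambda>x. g x * \<phi> n x) \<in> borel_measurable lborel" for n
        using smooth_fun_measurable[OF test_fun_smooth[OF \<phi>(1)[of n]]] by (intro borel_measurable_times) simp_all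
    qed measurable
    then have "(LINT x|lborel. g x * indicator (box a b) x) = 0"
      using orth[OF \<phi>(1)] by (simp add: LIMSEQ_const_iff)
    moreover have "(\<lambda>x. g x * indicator (box a b) x) = (\<lambda>x. indicator (box a b) x *\<^sub>R g x)"
      by (auto simp: indicator_def)
    ultimately show ?thesis by simp
  qed
  have zero: "AE x in lborel. indicator (box a b) x *\<^sub>R g x = 0" for a b
  proof (rule sigma_finite_measure.density_zero[OF sigma_finite_lborel int])
    fix A :: "'a set"
    assume "A \<in> sets lborel"
    then have A: "A \<in> sigma_sets UNIV (range (\<lambda>(a, b). box a b))"
      by (simp add: borel_eq_box)
    have "Int_stable (range (\<lambda>(a, b). box a b :: 'a set))"
      by (auto simp: Int_stable_def box_Int_box)
    moreover have "range (\<lambda>(a, b). box a b :: 'a set) \<subseteq> Pow UNIV"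
      by simp
    moreover note A
    ultimately show "set_lebesgue_integral lborel A (\<lambda>x. indicator (box a b) x *\<^sub>R g x) = 0"
      unfolding set_lebesgue_integral_def
    proof (induction rule: sigma_sets_induct_disjoint)
      case (basic A)
      then obtain c d where A: "A = box c d" by auto
      have "(\<lambda>x. indicator A x *\<^sub>R indicator (box a b) x *\<^sub>R g x)
          = (\<lambda>x. indicator (A \<inter> box a b) x *\<^sub>R g x)"
        by (auto simp: indicator_def)
      then show ?case
        unfolding A box_Int_box by (simp add: box0)
    next
      case (compl A)
      then have [measurable]: "A \<in> sets borel" by (simp add: borel_eq_box)
      have "(\<lambda>x. indicator (UNIV - A) x *\<^sub>R indicator (box a b) x *\<^sub>R g x)
          = (\<lambda>x. indicator (box a b) x *\<^sub>R g x - indicator A x *\<^sub>R indicator (box a b) x *\<^sub>R g x)"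
        by (auto simp: indicator_def)
      moreover have "integrable lborel (\<lambda>x. indicator A x *\<^sub>R indicator (box a b) x *\<^sub>R g x)"
        by (rule integrable_mult_indicator[OF _ int]) simp
      ultimately show ?case
        using compl by (simp only: Bochner_Integration.integral_diff[OF int] box0) simp
    next
      case (union A)
      then have [measurable]: "A i \<in> sets borel" for i by (auto simp: borel_eq_box)
      have "(LINT x:(\<Union>i. A i)|lborel. indicator (box a b) x *\<^sub>R g x)
          = (\<Sum>i. LINT x:(A i)|lborel. indicator (box a b) x *\<^sub>R g x)"
      proof (rule lebesgue_integral_countable_add)
        show "A i \<inter> A j = {}" if "i \<noteq> j" for i j
          using union(1) that by (auto simp: disjoint_family_on_def)
        show "set_integrable lborel (\<Union>i. A i) (\<lambda>x. indicator (box a b) x *\<^sub>R g x)"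
          unfolding set_integrable_def by (rule integrable_mult_indicator[OF _ int]) auto
      qed simp
      then show ?case
        using union(3) by (simp add: set_lebesgue_integral_def)
    qed auto
  qed
  have "AE x in lborel. \<forall>i::nat. indicator (box (- (real i *\<^sub>R One)) (real i *\<^sub>R One)) x *\<^sub>R g x = 0"
    unfolding AE_all_countable by (intro allI zero)
  then show ?thesis
  proof eventually_elim
    case (elim x)
    have "x \<in> (\<Union>i::nat. box (- (real i *\<^sub>R One)) (real i *\<^sub>R One))"
      by (simp add: UN_box_eq_UNIV)
    then obtain i :: nat where "x \<in> box (- (real i *\<^sub>R One)) (real i *\<^sub>R One)" by blast
    with elim[rule_format, of i] show ?case by simp
  qed
qed

section \<open>The Fourier transform of test functions\<close>

abbreviation character :: "'a::euclidean_space \<Rightarrow> 'a \<Rightarrow> complex" where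
  "character w x \<equiv> exp (\<i> * complex_of_real (x \<bullet> w))"

lemma norm_character: "cmod (character w x) = 1"
  by simp

lemma character_add: "character w x * character v x = character (w + v) x"
  by (simp add: exp_add[symmetric] inner_add_right distrib_left)

lemma fourier_character: "fourier \<phi> w = (LINT x|lborel. \<phi> x * character (- w) x)"
  unfolding fourier_def by (simp add: inner_commute)

lemma test_fun_integrable: "\<phi> \<in> test_fun \<Longrightarrow> integrable lborel \<phi>"
  using test_fun_in_schwartz schwartz_integrable by blast

lemma test_fun_character: "\<phi> \<in> test_fun \<Longrightarrow> (\<lambda>x. \<phi> x * character w x) \<in> test_fun"
  by (intro test_fun_mult smooth_fun_character)

text \<open>By translation invariance all difference quotients have integral \<open>0\<close>; they converge boundedly
  to the derivative and are supported in one ball.\<close>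

lemma integral_dir_deriv_eq_0:
  fixes \<phi> :: "'a::euclidean_space \<Rightarrow> complex"
  assumes \<phi>: "\<phi> \<in> test_fun" and e: "e \<in> Basis"
  shows "(LINT x|lborel. dir_deriv e \<phi> x) = 0"
proof -
  obtain R where R: "R > 0" "\<And>x. norm x > R \<Longrightarrow> \<phi> x = 0"
    using test_fun_bounded_support[OF \<phi>] by blast
  obtain B where B: "B > 0" "\<And>x. norm (dir_deriv e \<phi> x) \<le> B"
    using test_fun_bounded[OF test_fun_dir_deriv[OF \<phi> e]] by blast
  have sm: "smooth_fun \<phi>" by (rule test_fun_smooth[OF \<phi>])
  have [measurable]: "\<phi> \<in> borel_measurable borel" "dir_deriv e \<phi> \<in> borel_measurable borel"
    using smooth_fun_measurable[OF sm] smooth_fun_measurable[OF smooth_fun_dir_deriv[OF sm e]] by auto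
  \<comment> \<open>The factor \<open>1\<close> makes the argument an instance of an affine substitution.\<close>
  define q where "q n x = real (Suc n) *\<^sub>R (\<phi> (1 *\<^sub>R x + (1 / real (Suc n)) *\<^sub>R e) - \<phi> x)" for n x
  have lin: "linear (frechet_derivative \<phi> (at x))" for x
    using smooth_fun_has_derivative[OF sm] has_derivative_linear by blast
  have lim: "(\<lambda>n. q n x) \<longlonglongrightarrow> dir_deriv e \<phi> x" for x
  proof -
    let ?D = "frechet_derivative \<phi> (at x)"
    have 1: "((\<lambda>h. norm (\<phi> (x + h) - \<phi> x - ?D h) / norm h) \<longlongrightarrow> 0) (at 0)"
      using smooth_fun_has_derivative[OF sm, of x] unfolding has_derivative_at by blast
    have "(\<lambda>n. (1 / real (Suc n)) *\<^sub>R e) \<longlonglongrightarrow> 0 *\<^sub>R e"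
      using LIMSEQ_inverse_real_of_nat by (intro tendsto_scaleR tendsto_const) (simp add: inverse_eq_divide)
    then have 2: "filterlim (\<lambda>n. (1 / real (Suc n)) *\<^sub>R e) (at 0) sequentially"
      using e by (auto simp: filterlim_at)
    have "norm (\<phi> (x + (1 / real (Suc n)) *\<^sub>R e) - \<phi> x - ?D ((1 / real (Suc n)) *\<^sub>R e)) / norm ((1 / real (Suc n)) *\<^sub>R e)
        = norm (q n x - dir_deriv e \<phi> x)" for n
    proof -
      have "q n x - dir_deriv e \<phi> x
          = real (Suc n) *\<^sub>R (\<phi> (x + (1 / real (Suc n)) *\<^sub>R e) - \<phi> x - ?D ((1 / real (Suc n)) *\<^sub>R e))"
        unfolding q_def dir_deriv_def
        by (simp add: linear_scale[OF lin] scaleR_diff_right add.commute del: of_nat_Suc)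
      then show ?thesis
        using e by (simp add: mult.commute del: of_nat_Suc)
    qed
    with filterlim_compose[OF 1 2] have "(\<lambda>n. norm (q n x - dir_deriv e \<phi> x)) \<longlonglongrightarrow> 0"
      by simp
    then show ?thesis
      by (intro LIM_zero_cancel[of "\<lambda>n. q n x"] tendsto_norm_zero_cancel[of "\<lambda>n. q n x - dir_deriv e \<phi> x"])
  qed
  have bound: "norm (q n x) \<le> B * indicator (cball 0 (R + 1)) x" for n x
  proof (cases "norm x > R + 1")
    case True
    have "norm x \<le> norm (x + (1 / real (Suc n)) *\<^sub>R e) + norm ((1 / real (Suc n)) *\<^sub>R e)"
      using norm_triangle_ineq4[of "x + (1 / real (Suc n)) *\<^sub>R e" "(1 / real (Suc n)) *\<^sub>R e"] by simp
    also have "norm ((1 / real (Suc n)) *\<^sub>R e) \<le> 1"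
      using e by simp
    finally have "norm (x + (1 / real (Suc n)) *\<^sub>R e) > R"
      using True by linarith
    then show ?thesis
      using R(2)[of x] R(2)[of "x + (1 / real (Suc n)) *\<^sub>R e"] True by (simp add: q_def del: of_nat_Suc)
  next
    case False
    let ?\<eta> = "1 / real (Suc n)"
    have d: "((\<lambda>t. \<phi> (x + t *\<^sub>R e)) has_derivative (\<lambda>v. frechet_derivative \<phi> (at (x + t *\<^sub>R e)) (v *\<^sub>R e))) (at t)" for t :: real
    proof -
      have "((\<lambda>t. x + t *\<^sub>R e) has_derivative (\<lambda>v. v *\<^sub>R e)) (at t)"
        by (auto intro!: derivative_eq_intros)
      from has_derivative_compose[OF this smooth_fun_has_derivative[OF sm]] show ?thesis .
    qed
    have "continuous_on {0..?\<eta>} (\<lambda>t. \<phi> (x + t *\<^sub>R e))"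
      by (intro continuous_at_imp_continuous_on ballI has_derivative_continuous[OF d])
    from mvt_general[OF _ this d] obtain t
      where "norm (\<phi> (x + ?\<eta> *\<^sub>R e) - \<phi> (x + 0 *\<^sub>R e)) \<le> norm (frechet_derivative \<phi> (at (x + t *\<^sub>R e)) ((?\<eta> - 0) *\<^sub>R e))"
      by auto
    also have "\<dots> = ?\<eta> * norm (dir_deriv e \<phi> (x + t *\<^sub>R e))"
      by (simp add: linear_scale[OF lin] dir_deriv_def)
    also have "\<dots> \<le> ?\<eta> * B"
      by (intro mult_left_mono B) simp
    finally have "norm (\<phi> (x + ?\<eta> *\<^sub>R e) - \<phi> x) \<le> ?\<eta> * B"
      by simp
    then have "real (Suc n) * norm (\<phi> (x + ?\<eta> *\<^sub>R e) - \<phi> x) \<le> B"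
      by (simp add: field_simps del: of_nat_Suc)
    then have "norm (q n x) \<le> B"
      by (simp add: q_def del: of_nat_Suc)
    then show ?thesis
      using False by simp
  qed
  have "(\<lambda>n. LINT x|lborel. q n x) \<longlonglongrightarrow> (LINT x|lborel. dir_deriv e \<phi> x)"
  proof (rule integral_dominated_convergence)
    show "integrable lborel (\<lambda>x. B * indicator (cball 0 (R + 1)) (x::'a))"
      by (intro integrable_mult_right integrable_real_indicator) (auto simp: emeasure_compact_finite[OF compact_cball, unfolded infinity_ennreal_def])
    show "q n \<in> borel_measurable lborel" for n
      unfolding q_def by measurable
    show "AE x in lborel. (\<lambda>n. q n x) \<longlonglongrightarrow> dir_deriv e \<phi> x"
      using lim by (intro AE_I2)
    show "AE x in lborel. norm (q n x) \<le> B * indicator (cball 0 (R + 1)) x" for n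
      using bound by (intro AE_I2)
  qed measurable
  moreover have "(LINT x|lborel. q n x) = 0" for n
  proof -
    have int: "integrable lborel \<phi>" by (rule test_fun_integrable[OF \<phi>])
    have "(LINT x|lborel. q n x) = real (Suc n) *\<^sub>R
        ((LINT x|lborel. \<phi> (1 *\<^sub>R x + (1 / real (Suc n)) *\<^sub>R e)) - (LINT x|lborel. \<phi> x))"
      unfolding q_def using int lborel_integral_affine(1)[of 1 \<phi> "(1 / real (Suc n)) *\<^sub>R e"]
      by (subst integral_scaleR_right, subst Bochner_Integration.integral_diff) (auto simp del: of_nat_Suc)
    also have "(LINT x|lborel. \<phi> (1 *\<^sub>R x + (1 / real (Suc n)) *\<^sub>R e)) = (LINT x|lborel. \<phi> x)"
      using lborel_integral_affine(2)[of 1 \<phi> "(1 / real (Suc n)) *\<^sub>R e"] by (simp del: of_nat_Suc)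
    finally show ?thesis by simp
  qed
  ultimately show ?thesis
    by (simp add: LIMSEQ_const_iff)
qed

text \<open>Integration by parts: the directional derivative of \<open>\<phi>\<close> times a character has integral \<open>0\<close>.\<close>

lemma fourier_dir_deriv:
  assumes \<phi>: "\<phi> \<in> test_fun" and e: "e \<in> Basis"
  shows "fourier (dir_deriv e \<phi>) w = \<i> * of_real (w \<bullet> e) * fourier \<phi> w"
proof -
  let ?\<psi> = "\<lambda>x. \<phi> x * character (- w) x"
  have sm: "smooth_fun \<phi>" by (rule test_fun_smooth[OF \<phi>])
  have eq: "dir_deriv e ?\<psi> = (\<lambda>x. dir_deriv e \<phi> x * character (- w) x - \<i> * of_real (w \<bullet> e) * (\<phi> x * character (- w) x))"
    unfolding dir_deriv_mult[OF sm smooth_fun_character] dir_deriv_character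
    by (simp add: inner_commute[of e] algebra_simps)
  have "0 = (LINT x|lborel. dir_deriv e ?\<psi> x)"
    by (rule integral_dir_deriv_eq_0[OF test_fun_character[OF \<phi>] e, symmetric])
  also have "\<dots> = fourier (dir_deriv e \<phi>) w - \<i> * of_real (w \<bullet> e) * fourier \<phi> w"
    unfolding eq fourier_character integral_mult_right_zero[symmetric]
    by (rule Bochner_Integration.integral_diff)
      (intro integrable_mult_right test_fun_integrable test_fun_character test_fun_dir_deriv \<phi> e)+
  finally show ?thesis by simp
qed

lemma fourier_bounded: "cmod (fourier \<phi> w) \<le> (LINT x|lborel. cmod (\<phi> x))"
proof -
  have "cmod (fourier \<phi> w) \<le> (LINT x|lborel. cmod (\<phi> x * character (- w) x))"
    unfolding fourier_character by (rule integral_norm_bound)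
  then show ?thesis by (simp only: norm_mult norm_character mult_1_right)
qed

lemma test_fun_inner_mult: "\<phi> \<in> test_fun \<Longrightarrow> (\<lambda>x. - \<i> * of_real (x \<bullet> v) * \<phi> x) \<in> test_fun"
  using test_fun_mult[OF _ smooth_fun_cmult[OF smooth_fun_inner[of v], of "- \<i>"]] by (simp add: mult.commute)

text \<open>Differentiation under the integral sign. The second order Taylor bound for the character gives a
  quadratic remainder, as \<open>\<phi>\<close> has compact support.\<close>

lemma fourier_has_derivative:
  fixes \<phi> :: "'a::euclidean_space \<Rightarrow> complex"
  assumes \<phi>: "\<phi> \<in> test_fun"
  shows "(fourier \<phi> has_derivative (\<lambda>v. fourier (\<lambda>x. - \<i> * of_real (x \<bullet> v) * \<phi> x) w)) (at w)"
proof -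
  let ?L = "\<lambda>v. fourier (\<lambda>x. - \<i> * of_real (x \<bullet> v) * \<phi> x) w"
  obtain R where R: "R > 0" "\<And>x. norm x > R \<Longrightarrow> \<phi> x = 0"
    using test_fun_bounded_support[OF \<phi>] by blast
  define I where "I = (LINT x|lborel. cmod (\<phi> x))"
  have I0: "I \<ge> 0" unfolding I_def by (rule integral_nonneg_AE) auto
  have int: "integrable lborel (\<lambda>x. \<phi> x * character u x)" for u
    by (intro test_fun_integrable test_fun_character \<phi>)
  have intv: "integrable lborel (\<lambda>x. - \<i> * of_real (x \<bullet> v) * \<phi> x * character u x)" for u v
    by (intro test_fun_integrable test_fun_character test_fun_inner_mult \<phi>)
  have intn: "integrable lborel (\<lambda>x. cmod (\<phi> x))"
    by (intro integrable_norm test_fun_integrable \<phi>)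
  have inner_bound: "\<bar>x \<bullet> v\<bar> * cmod (\<phi> x) \<le> R * norm v * cmod (\<phi> x)" for x v
  proof (cases "norm x > R")
    case False
    then have "\<bar>x \<bullet> v\<bar> \<le> R * norm v"
      using Cauchy_Schwarz_ineq2[of x v] mult_right_mono[of "norm x" R "norm v"] by simp
    then show ?thesis by (rule mult_right_mono) simp
  qed (simp add: R)
  have "bounded_linear ?L"
  proof (rule bounded_linear_intro)
    show "?L (v + v') = ?L v + ?L v'" for v v'
      unfolding fourier_character
      by (subst Bochner_Integration.integral_add[symmetric, OF intv intv]) (simp add: algebra_simps)
    show "?L (r *\<^sub>R v) = r *\<^sub>R ?L v" for r v
      unfolding fourier_character integral_scaleR_right[symmetric] 
      by (simp add: scaleR_conv_of_real mult_ac)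
    show "norm (?L v) \<le> norm v * (R * I)" for v
    proof -
      have "norm (?L v) \<le> (LINT x|lborel. cmod (- \<i> * of_real (x \<bullet> v) * \<phi> x))"
        by (rule fourier_bounded)
      also have "\<dots> \<le> (LINT x|lborel. R * norm v * cmod (\<phi> x))"
        using test_fun_integrable[OF test_fun_inner_mult[OF \<phi>]] inner_bound
        by (intro integral_mono integrable_norm integrable_mult_right intn) (simp_all add: norm_mult)
      finally show ?thesis
        by (simp add: I_def mult_ac)
    qed
  qed
  moreover have "((\<lambda>h. norm (fourier \<phi> (w + h) - fourier \<phi> w - ?L h) / norm h) \<longlongrightarrow> 0) (at 0)"
  proof (rule Lim_null_comparison)
    have "((\<lambda>h::'a. R\<^sup>2 * I * norm h) \<longlongrightarrow> R\<^sup>2 * I * norm (0::'a)) (at 0)"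
      by (intro tendsto_mult_left tendsto_norm tendsto_ident_at)
    then show "((\<lambda>h::'a. R\<^sup>2 * I * norm h) \<longlongrightarrow> 0) (at 0)"
      by simp
    have "norm (fourier \<phi> (w + h) - fourier \<phi> w - ?L h) \<le> (R\<^sup>2 * I * norm h) * norm h" for h
    proof -
      let ?r = "\<lambda>x. \<phi> x * character (- (w + h)) x - \<phi> x * character (- w) x
          - (- \<i> * of_real (x \<bullet> h) * \<phi> x) * character (- w) x"
      have ir: "integrable lborel ?r"
        by (rule Bochner_Integration.integrable_diff[OF Bochner_Integration.integrable_diff[OF int int] intv])
      have diff: "fourier \<phi> (w + h) - fourier \<phi> w - ?L h = (LINT x|lborel. ?r x)"
        unfolding fourier_character
          Bochner_Integration.integral_diff[OF Bochner_Integration.integrable_diff[OF int int] intv]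
          Bochner_Integration.integral_diff[OF int int] ..
      have "norm (fourier \<phi> (w + h) - fourier \<phi> w - ?L h) \<le> (LINT x|lborel. cmod (?r x))"
        unfolding diff by (rule integral_norm_bound)
      also have "\<dots> \<le> (LINT x|lborel. R\<^sup>2 * (norm h)\<^sup>2 * cmod (\<phi> x))"
      proof (rule integral_mono)
        show "integrable lborel (\<lambda>x. cmod (?r x))"
          by (rule integrable_norm[OF ir])
        show "integrable lborel (\<lambda>x. R\<^sup>2 * (norm h)\<^sup>2 * cmod (\<phi> x))"
          by (rule integrable_mult_right[OF intn])
        fix x
        let ?t = "- (x \<bullet> h)"
        have "cmod (iexp ?t - (\<Sum>k\<le>1. (\<i> * complex_of_real ?t) ^ k / fact k)) \<le> \<bar>?t\<bar> ^ Suc 1 / fact (Suc 1)"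
          by (rule iexp_approx1)
        moreover have "iexp ?t - (\<Sum>k\<le>1. (\<i> * complex_of_real ?t) ^ k / fact k) = iexp ?t - 1 - \<i> * of_real ?t"
          by (simp add: diff_diff_eq)
        moreover have "\<bar>?t\<bar> ^ Suc 1 / fact (Suc 1) = \<bar>x \<bullet> h\<bar>\<^sup>2 / 2"
          by (simp add: numeral_2_eq_2)
        moreover have "\<bar>x \<bullet> h\<bar>\<^sup>2 / 2 \<le> \<bar>x \<bullet> h\<bar>\<^sup>2"
          by simp
        ultimately have tay: "cmod (iexp ?t - 1 - \<i> * of_real ?t) \<le> \<bar>x \<bullet> h\<bar>\<^sup>2"
          by (simp only:)
        have "?r x = \<phi> x * character (- w) x * (iexp ?t - 1 - \<i> * of_real ?t)"
        proof -
          have "character (- (w + h)) x = character (- w) x * iexp ?t"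
            using character_add[of x "- w" "- h"] by simp
          then show ?thesis
            by (simp only: right_diff_distrib of_real_minus mult_minus_right mult_minus_left mult_1_right mult_1_left mult_ac)
        qed
        then have "cmod (?r x) \<le> cmod (\<phi> x) * \<bar>x \<bullet> h\<bar>\<^sup>2"
          using mult_left_mono[OF tay, of "cmod (\<phi> x)"] by (simp add: norm_mult)
        also have "\<dots> \<le> (R * norm h) * (\<bar>x \<bullet> h\<bar> * cmod (\<phi> x))"
          using mult_right_mono[OF inner_bound[of x h], of "\<bar>x \<bullet> h\<bar>"] by (simp add: power2_eq_square mult_ac)
        also have "\<dots> \<le> (R * norm h) * (R * norm h * cmod (\<phi> x))"
          using R(1) by (intro mult_left_mono inner_bound) auto
        finally show "cmod (?r x) \<le> R\<^sup>2 * (norm h)\<^sup>2 * cmod (\<phi> x)"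
          by (simp add: power2_eq_square mult_ac)
      qed
      finally show ?thesis
        by (simp add: I_def power2_eq_square mult_ac)
    qed
    then show "\<forall>\<^sub>F h in at 0. norm (norm (fourier \<phi> (w + h) - fourier \<phi> w - ?L h) / norm h) \<le> R\<^sup>2 * I * norm h"
      by (auto simp: eventually_at_filter divide_le_eq)
  qed
  ultimately show ?thesis
    unfolding has_derivative_at by blast
qed

lemma smooth_fun_fourier:
  assumes "\<phi> \<in> test_fun"
  shows "smooth_fun (fourier \<phi>)"
proof (rule smooth_fun_coinduct[where X="\<lambda>f. f \<in> fourier ` test_fun"])
  fix f :: "'a \<Rightarrow> complex"
  assume "f \<in> fourier ` test_fun"
  then obtain \<psi> where \<psi>: "\<psi> \<in> test_fun" and f: "f = fourier \<psi>" by blast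
  show "f differentiable at w" for w
    unfolding f differentiable_def using fourier_has_derivative[OF \<psi>] by blast
  show "dir_deriv b f \<in> fourier ` test_fun" for b
    unfolding f dir_deriv_eqI[OF fourier_has_derivative[OF \<psi>]]
    using test_fun_inner_mult[OF \<psi>] by blast
qed (use assms in blast)

lemma partial_derivs_fourier:
  assumes "\<phi> \<in> test_fun"
  obtains \<psi> where "\<psi> \<in> test_fun" "partial_derivs bs (fourier \<phi>) = fourier \<psi>"
proof -
  have "partial_derivs bs (fourier \<phi>) \<in> fourier ` test_fun"
  proof (induction bs)
    case (Cons b bs)
    then obtain \<psi> where \<psi>: "\<psi> \<in> test_fun" and f: "partial_derivs bs (fourier \<phi>) = fourier \<psi>" by blast
    show ?case
      unfolding partial_derivs_Cons f dir_deriv_eqI[OF fourier_has_derivative[OF \<psi>]]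
      using test_fun_inner_mult[OF \<psi>] by blast
  qed (use assms in simp)
  then show ?thesis
    using that by blast
qed

text \<open>A factor \<open>norm w\<close> is paid for by one more derivative of \<open>\<phi>\<close>.\<close>

lemma fourier_decay:
  assumes "\<phi> \<in> test_fun"
  shows "\<exists>B. \<forall>w. (1 + norm w) ^ m * cmod (fourier \<phi> w) \<le> B"
  using assms
proof (induction m arbitrary: \<phi>)
  case 0
  show ?case
    by (intro exI[of _ "LINT x|lborel. cmod (\<phi> x)"]) (simp add: fourier_bounded)
next
  case (Suc m)
  obtain B where B: "\<And>w. (1 + norm w) ^ m * cmod (fourier \<phi> w) \<le> B"
    using Suc.IH[OF Suc.prems] by blast
  have "\<forall>e\<in>Basis. \<exists>C. \<forall>w. (1 + norm w) ^ m * cmod (fourier (dir_deriv e \<phi>) w) \<le> C"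
    using Suc.IH[OF test_fun_dir_deriv[OF Suc.prems]] by blast
  then obtain C where C: "\<And>e w. e \<in> Basis \<Longrightarrow> (1 + norm w) ^ m * cmod (fourier (dir_deriv e \<phi>) w) \<le> C e"
    by metis
  have "(1 + norm w) ^ Suc m * cmod (fourier \<phi> w) \<le> B + (\<Sum>e\<in>Basis. C e)" for w
  proof -
    have "(1 + norm w) ^ Suc m * cmod (fourier \<phi> w) = (1 + norm w) * ((1 + norm w) ^ m * cmod (fourier \<phi> w))"
      by simp
    also have "\<dots> \<le> (1 + (\<Sum>e\<in>Basis. \<bar>w \<bullet> e\<bar>)) * ((1 + norm w) ^ m * cmod (fourier \<phi> w))"
      by (intro mult_right_mono add_left_mono norm_le_l1) auto
    also have "\<dots> = (1 + norm w) ^ m * cmod (fourier \<phi> w)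
        + (\<Sum>e\<in>Basis. \<bar>w \<bullet> e\<bar> * ((1 + norm w) ^ m * cmod (fourier \<phi> w)))"
      by (simp add: distrib_right sum_distrib_right)
    also have "\<dots> = (1 + norm w) ^ m * cmod (fourier \<phi> w)
        + (\<Sum>e\<in>Basis. (1 + norm w) ^ m * cmod (fourier (dir_deriv e \<phi>) w))"
      by (intro arg_cong2[where f="(+)"] sum.cong refl) (simp_all add: fourier_dir_deriv[OF Suc.prems] norm_mult)
    also have "\<dots> \<le> B + (\<Sum>e\<in>Basis. C e)"
      by (intro add_mono sum_mono B C)
    finally show ?thesis .
  qed
  then show ?case by blast
qed

lemma fourier_test_schwartz:
  assumes "\<phi> \<in> test_fun"
  shows "fourier \<phi> \<in> schwartz"
proof (rule schwartzI[OF smooth_fun_fourier[OF assms]])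
  fix bs :: "'a list" and m :: nat
  show "\<exists>B. \<forall>x. (1 + norm x) ^ m * cmod (partial_derivs bs (fourier \<phi>) x) \<le> B"
    using partial_derivs_fourier[OF assms, of bs] fourier_decay by metis
qed

section \<open>Fourier inversion\<close>

text \<open>With the Fourier kernel this is the multiplication formula for the Fourier transform.\<close>

lemma fubini_bounded_kernel:
  fixes a b :: "'a::euclidean_space \<Rightarrow> complex" and k :: "'a \<Rightarrow> 'a \<Rightarrow> complex"
  assumes a: "integrable lborel a" and b: "integrable lborel b"
    and k[measurable]: "(\<lambda>(x, y). k x y) \<in> borel_measurable (lborel \<Otimes>\<^sub>M lborel)"
    and k1: "\<And>x y. cmod (k x y) \<le> 1"
  shows "(LINT x|lborel. a x * (LINT y|lborel. b y * k x y)) = (LINT y|lborel. b y * (LINT x|lborel. a x * k x y))"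
proof -
  note [measurable] = borel_measurable_integrable[OF a] borel_measurable_integrable[OF b]
  let ?f = "\<lambda>x y. a x * (b y * k x y)"
  have bk: "integrable lborel (\<lambda>y. b y * k x y)" for x
    by (rule Bochner_Integration.integrable_bound[OF integrable_norm[OF b]])
      (auto simp: norm_mult intro!: mult_left_le k1)
  have int: "integrable (lborel \<Otimes>\<^sub>M lborel) (case_prod ?f)"
  proof (rule lborel_pair.Fubini_integrable)
    show "AE x in lborel. integrable lborel (\<lambda>y. case (x, y) of (x, y) \<Rightarrow> ?f x y)"
      using bk by auto
    show "integrable lborel (\<lambda>x. LINT y|lborel. cmod (case (x, y) of (x, y) \<Rightarrow> ?f x y))"
    proof (rule Bochner_Integration.integrable_bound)
      show "integrable lborel (\<lambda>x. cmod (a x) * (LINT y|lborel. cmod (b y)))"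
        by (intro integrable_mult_left integrable_norm a)
      have "(LINT y|lborel. cmod (?f x y)) \<le> cmod (a x) * (LINT y|lborel. cmod (b y))" for x
      proof -
        have "(LINT y|lborel. cmod (?f x y)) \<le> (LINT y|lborel. cmod (a x) * cmod (b y))"
          using bk b by (intro integral_mono integrable_norm integrable_mult_right)
            (auto simp: norm_mult intro!: mult_left_mono mult_left_le k1)
        then show ?thesis by simp
      qed
      moreover have "0 \<le> (LINT y|lborel. cmod (?f x y))" for x
        by (rule integral_nonneg_AE) auto
      ultimately show "AE x in lborel. norm (LINT y|lborel. cmod (case (x, y) of (x, y) \<Rightarrow> ?f x y))
          \<le> norm (cmod (a x) * (LINT y|lborel. cmod (b y)))"
        by (intro AE_I2) (use order_trans[OF _ abs_ge_self] in simp)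
    qed measurable
  qed measurable
  have "(LINT x|lborel. a x * (LINT y|lborel. b y * k x y)) = (LINT x|lborel. (LINT y|lborel. ?f x y))"
    by simp
  also have "\<dots> = (LINT y|lborel. (LINT x|lborel. ?f x y))"
    by (rule lborel_pair.Fubini_integral[OF int, symmetric])
  also have "\<dots> = (LINT y|lborel. b y * (LINT x|lborel. a x * k x y))"
    by (simp add: mult.left_commute[of "a _" "b _"])
  finally show ?thesis .
qed

abbreviation gauss :: "'a::euclidean_space \<Rightarrow> real" where
  "gauss x \<equiv> exp (- ((norm x)\<^sup>2 / 2))"

lemma gauss_prod: "gauss x = (\<Prod>b\<in>Basis. exp (- ((x \<bullet> b)\<^sup>2 / 2)))"
proof -
  have "(norm x)\<^sup>2 = (\<Sum>b\<in>Basis. (x \<bullet> b)\<^sup>2)"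
    unfolding power2_norm_eq_inner by (subst euclidean_inner) (simp add: power2_eq_square)
  then show ?thesis
    by (simp add: exp_sum[symmetric] sum_negf sum_divide_distrib)
qed

text \<open>The characteristic function of the standard normal distribution, freed from its normalisation.\<close>

lemma gauss_fourier_real:
  shows "integrable lborel (\<lambda>u::real. iexp (u * t) * complex_of_real (exp (- (u\<^sup>2 / 2))))"
    and "(LINT u|lborel. iexp (u * t) * complex_of_real (exp (- (u\<^sup>2 / 2))))
           = complex_of_real (sqrt (2 * pi) * exp (- (t\<^sup>2 / 2)))"
proof -
  let ?f = "\<lambda>u::real. iexp (u * t) * complex_of_real (exp (- (u\<^sup>2 / 2)))"
  let ?c = "1 / sqrt (2 * pi)"
  have eq: "std_normal_density u *\<^sub>R iexp (t * u) = ?c *\<^sub>R ?f u" for u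
    by (simp add: std_normal_density_def scaleR_conv_of_real mult_ac)
  have s: "sqrt (2 * pi) > 0" by simp
  have "integrable lborel (\<lambda>u. ?c *\<^sub>R ?f u)"
  proof (rule Bochner_Integration.integrable_bound)
    show "integrable lborel std_normal_density"
      by (rule integrable_normal_density) simp
    show "AE u in lborel. norm (?c *\<^sub>R ?f u) \<le> norm (std_normal_density u)"
      by (auto simp: std_normal_density_def norm_mult)
  qed measurable
  from integrable_scaleR_right[OF this, of "sqrt (2 * pi)"] show "integrable lborel ?f"
    by simp
  have "complex_of_real (exp (- t\<^sup>2 / 2)) = char std_normal_distribution t"
    by (simp add: char_std_normal_distribution)
  also have "\<dots> = (LINT u|lborel. std_normal_density u *\<^sub>R iexp (t * u))"
    unfolding char_def by (rule integral_density) auto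
  also have "\<dots> = ?c *\<^sub>R (LINT u|lborel. ?f u)"
    unfolding eq by (rule integral_scaleR_right)
  finally show "(LINT u|lborel. ?f u) = complex_of_real (sqrt (2 * pi) * exp (- (t\<^sup>2 / 2)))"
    using s by (simp add: scaleR_conv_of_real field_simps)
qed

lemma gauss_fourier:
  fixes z :: "'a::euclidean_space"
  shows "integrable lborel (\<lambda>x. character z x * complex_of_real (gauss x))"
    and "(LINT x|lborel. character z x * complex_of_real (gauss x))
          = complex_of_real (sqrt (2 * pi) ^ DIM('a) * gauss z)"
proof -
  let ?f = "\<lambda>b u. iexp (u * (z \<bullet> b)) * complex_of_real (exp (- (u\<^sup>2 / 2)))"
  have eq: "character z x * complex_of_real (gauss x) = (\<Prod>b\<in>Basis. ?f b (x \<bullet> b))" for x :: 'a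
  proof -
    have "character z x = (\<Prod>b\<in>Basis. iexp ((x \<bullet> b) * (z \<bullet> b)))"
      by (subst euclidean_inner) (simp add: exp_sum[symmetric] sum_distrib_left)
    then show ?thesis
      by (simp add: gauss_prod[of x] prod.distrib)
  qed
  show "integrable lborel (\<lambda>x. character z x * complex_of_real (gauss x))"
    unfolding eq by (rule lborel_prod_integral) (rule gauss_fourier_real)
  have "(LINT x|lborel. character z x * complex_of_real (gauss x))
      = (\<Prod>b\<in>(Basis::'a set). complex_of_real (sqrt (2 * pi) * exp (- ((z \<bullet> b)\<^sup>2 / 2))))"
    unfolding eq by (subst lborel_prod_integral(2)) (auto simp only: gauss_fourier_real)
  also have "\<dots> = complex_of_real (sqrt (2 * pi) ^ DIM('a) * gauss z)"
    unfolding gauss_prod[of z] of_real_prod[symmetric] prod.distrib by simp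
  finally show "(LINT x|lborel. character z x * complex_of_real (gauss x))
          = complex_of_real (sqrt (2 * pi) ^ DIM('a) * gauss z)" .
qed

lemma gauss_integrable: "integrable lborel (\<lambda>x::'a::euclidean_space. complex_of_real (gauss x))"
  using gauss_fourier(1)[of 0] by simp

lemma character_measurable_pair:
  "(\<lambda>(x, y). character (c *\<^sub>R y) (x::'a::euclidean_space)) \<in> borel_measurable (lborel \<Otimes>\<^sub>M lborel)"
  by measurable

text \<open>The Gaussian factor makes the double integral absolutely convergent. After exchanging the
  integrals it becomes an average of \<open>\<phi>\<close> near \<open>w\<close> on the scale \<open>d\<close>.\<close>

lemma fourier_inversion_gauss:
  fixes \<phi> :: "'a::euclidean_space \<Rightarrow> complex"
  assumes \<phi>: "\<phi> \<in> test_fun" and d: "d > 0"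
  shows "(LINT x|lborel. fourier \<phi> x * (character w x * complex_of_real (gauss (d *\<^sub>R x))))
    = complex_of_real (sqrt (2 * pi) ^ DIM('a)) * (LINT u|lborel. \<phi> (d *\<^sub>R u + w) * complex_of_real (gauss u))"
proof -
  let ?s = "complex_of_real (sqrt (2 * pi) ^ DIM('a))"
  let ?a = "\<lambda>x. character w x * complex_of_real (gauss (d *\<^sub>R x))"
  have [measurable]: "\<phi> \<in> borel_measurable borel"
    by (rule smooth_fun_measurable[OF test_fun_smooth[OF \<phi>]])
  have scale: "(\<lambda>x. character ((1/d) *\<^sub>R z) (d *\<^sub>R x + 0) * complex_of_real (gauss (d *\<^sub>R x + 0)))
      = (\<lambda>x. character z x * complex_of_real (gauss (d *\<^sub>R x)))" for z :: 'a
    using d by simp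
  have a: "integrable lborel ?a"
    using gauss_fourier(1)[of "(1/d) *\<^sub>R w"] d
      lborel_integral_affine(1)[of d "\<lambda>x. character ((1/d) *\<^sub>R w) x * complex_of_real (gauss x)" 0]
    by (simp add: scale)
  have inner: "of_real (d ^ DIM('a)) * (LINT x|lborel. character z x * complex_of_real (gauss (d *\<^sub>R x)))
      = ?s * gauss ((1/d) *\<^sub>R z)" for z :: 'a
    using gauss_fourier(2)[of "(1/d) *\<^sub>R z"] d
      lborel_integral_affine(2)[of d "\<lambda>x. character ((1/d) *\<^sub>R z) x * complex_of_real (gauss x)" 0]
    unfolding scale by (simp add: scaleR_conv_of_real)
  have "(LINT x|lborel. fourier \<phi> x * ?a x) = (LINT x|lborel. ?a x * (LINT y|lborel. \<phi> y * character ((-1) *\<^sub>R x) y))"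
    unfolding fourier_character by (simp add: mult.commute)
  also have "\<dots> = (LINT x|lborel. ?a x * (LINT y|lborel. \<phi> y * character ((-1) *\<^sub>R y) x))"
    by (simp add: inner_commute)
  also have "\<dots> = (LINT y|lborel. \<phi> y * (LINT x|lborel. ?a x * character ((-1) *\<^sub>R y) x))"
    by (rule fubini_bounded_kernel[OF a test_fun_integrable[OF \<phi>] character_measurable_pair]) simp
  also have "(\<lambda>y x. ?a x * character ((-1) *\<^sub>R y) x) = (\<lambda>y x. character (w - y) x * complex_of_real (gauss (d *\<^sub>R x)))"
  proof (intro ext)
    fix y x
    have "?a x * character ((-1) *\<^sub>R y) x = (character w x * character ((-1) *\<^sub>R y) x) * complex_of_real (gauss (d *\<^sub>R x))"
      by (simp only: mult_ac)
    also have "character w x * character ((-1) *\<^sub>R y) x = character (w - y) x"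
      by (simp only: character_add) simp
    finally show "?a x * character ((-1) *\<^sub>R y) x = character (w - y) x * complex_of_real (gauss (d *\<^sub>R x))" .
  qed
  also have "(LINT y|lborel. \<phi> y * (LINT x|lborel. character (w - y) x * complex_of_real (gauss (d *\<^sub>R x))))
     = of_real (d ^ DIM('a)) * (LINT u|lborel. \<phi> (d *\<^sub>R u + w) * (LINT x|lborel. character (w - (d *\<^sub>R u + w)) x * complex_of_real (gauss (d *\<^sub>R x))))"
    using d by (subst lborel_integral_affine(2)[of d _ w]) (auto simp: scaleR_conv_of_real)
  also have "\<dots> = (LINT u|lborel. \<phi> (d *\<^sub>R u + w) * (of_real (d ^ DIM('a)) *
      (LINT x|lborel. character (w - (d *\<^sub>R u + w)) x * complex_of_real (gauss (d *\<^sub>R x)))))"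
    by (subst integral_mult_right_zero[symmetric]) (simp only: mult.left_commute)
  also have "\<dots> = (LINT u|lborel. \<phi> (d *\<^sub>R u + w) * (?s * gauss u))"
    unfolding inner using d by simp
  also have "\<dots> = ?s * (LINT u|lborel. \<phi> (d *\<^sub>R u + w) * complex_of_real (gauss u))"
    unfolding mult.left_commute[of _ ?s] by (rule integral_mult_right_zero)
  finally show ?thesis .
qed

text \<open>As \<open>d\<close> tends to \<open>0\<close>, the Gaussian factor tends to \<open>1\<close> and the average of \<open>\<phi>\<close> to \<open>\<phi> w\<close>.\<close>

lemma fourier_inversion:
  fixes \<phi> :: "'a::euclidean_space \<Rightarrow> complex"
  assumes \<phi>: "\<phi> \<in> test_fun"
  shows "(LINT x|lborel. fourier \<phi> x * character w x) = complex_of_real ((2 * pi) ^ DIM('a)) * \<phi> w"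
proof -
  let ?s = "complex_of_real (sqrt (2 * pi) ^ DIM('a))"
  let ?d = "\<lambda>n. inverse (real (Suc n))"
  have [measurable]: "\<phi> \<in> borel_measurable borel"
    by (rule smooth_fun_measurable[OF test_fun_smooth[OF \<phi>]])
  have [measurable]: "fourier \<phi> \<in> borel_measurable borel"
    by (rule smooth_fun_measurable[OF smooth_fun_fourier[OF \<phi>]])
  obtain B where B: "B > 0" "\<And>x. norm (\<phi> x) \<le> B"
    using test_fun_bounded[OF \<phi>] by blast
  have d0: "?d \<longlonglongrightarrow> 0" by (rule LIMSEQ_inverse_real_of_nat)
  have "(\<lambda>n. LINT x|lborel. fourier \<phi> x * (character w x * complex_of_real (gauss (?d n *\<^sub>R x))))
      \<longlonglongrightarrow> (LINT x|lborel. fourier \<phi> x * character w x)"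
  proof (rule integral_dominated_convergence)
    show "integrable lborel (\<lambda>x. cmod (fourier \<phi> x))"
      by (intro integrable_norm schwartz_integrable fourier_test_schwartz \<phi>)
    show "AE x in lborel. (\<lambda>n. fourier \<phi> x * (character w x * complex_of_real (gauss (?d n *\<^sub>R x))))
        \<longlonglongrightarrow> fourier \<phi> x * character w x"
    proof (rule AE_I2)
      fix x
      have "(\<lambda>n. fourier \<phi> x * (character w x * complex_of_real (gauss (?d n *\<^sub>R x))))
          \<longlonglongrightarrow> fourier \<phi> x * (character w x * complex_of_real (gauss (0 *\<^sub>R x)))"
        by (intro tendsto_intros d0) simp
      then show "(\<lambda>n. fourier \<phi> x * (character w x * complex_of_real (gauss (?d n *\<^sub>R x))))
        \<longlonglongrightarrow> fourier \<phi> x * character w x" by simp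
    qed
    show "AE x in lborel. norm (fourier \<phi> x * (character w x * complex_of_real (gauss (?d n *\<^sub>R x)))) \<le> cmod (fourier \<phi> x)" for n
      by (intro AE_I2) (simp add: norm_mult mult_left_le)
  qed measurable
  moreover have "(\<lambda>n. LINT u|lborel. \<phi> (?d n *\<^sub>R u + w) * complex_of_real (gauss u))
      \<longlonglongrightarrow> (LINT u|lborel. \<phi> w * complex_of_real (gauss (u::'a)))"
  proof (rule integral_dominated_convergence)
    show "integrable lborel (\<lambda>x::'a. B * cmod (complex_of_real (gauss x)))"
      by (intro integrable_mult_right integrable_norm gauss_integrable)
    show "AE u in lborel. (\<lambda>n. \<phi> (?d n *\<^sub>R u + w) * complex_of_real (gauss u)) \<longlonglongrightarrow> \<phi> w * complex_of_real (gauss u)"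
    proof (intro AE_I2 tendsto_mult tendsto_const)
      fix u
      have "(\<lambda>n. ?d n *\<^sub>R u + w) \<longlonglongrightarrow> 0 *\<^sub>R u + w"
        by (intro tendsto_intros d0)
      moreover have "isCont \<phi> w"
        using smooth_fun_continuous[OF test_fun_smooth[OF \<phi>], of UNIV] by (simp add: continuous_on_eq_continuous_at)
      ultimately show "(\<lambda>n. \<phi> (?d n *\<^sub>R u + w)) \<longlonglongrightarrow> \<phi> w"
        by (intro isCont_tendsto_compose[of w \<phi>]) simp_all
    qed
    show "AE u in lborel. norm (\<phi> (?d n *\<^sub>R u + w) * complex_of_real (gauss u)) \<le> B * cmod (complex_of_real (gauss u))" for n
      by (intro AE_I2) (simp only: norm_mult, intro mult_right_mono B norm_ge_zero)
  qed measurable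
  then have "(\<lambda>n. ?s * (LINT u|lborel. \<phi> (?d n *\<^sub>R u + w) * complex_of_real (gauss u)))
      \<longlonglongrightarrow> ?s * (LINT u|lborel. \<phi> w * complex_of_real (gauss (u::'a)))"
    by (rule tendsto_mult_left)
  moreover have "(LINT x|lborel. fourier \<phi> x * (character w x * complex_of_real (gauss (?d n *\<^sub>R x))))
      = ?s * (LINT u|lborel. \<phi> (?d n *\<^sub>R u + w) * complex_of_real (gauss u))" for n
    by (rule fourier_inversion_gauss[OF \<phi>]) simp
  ultimately have "(LINT x|lborel. fourier \<phi> x * character w x) = ?s * (LINT u|lborel. \<phi> w * complex_of_real (gauss (u::'a)))"
    by (auto intro: LIMSEQ_unique)
  also have "\<dots> = ?s * (\<phi> w * ?s)"
    using gauss_fourier(2)[of "0::'a"] by simp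
  also have "\<dots> = complex_of_real ((2 * pi) ^ DIM('a)) * \<phi> w"
  proof -
    have "sqrt (2 * pi) ^ DIM('a) * sqrt (2 * pi) ^ DIM('a) = (2 * pi) ^ DIM('a)"
      by (simp only: power_mult_distrib[symmetric] real_sqrt_mult_self) simp
    then have "?s * ?s = complex_of_real ((2 * pi) ^ DIM('a))"
      by (simp only: of_real_mult[symmetric])
    moreover have "?s * (\<phi> w * ?s) = (?s * ?s) * \<phi> w"
      by (simp only: mult_ac)
    ultimately show ?thesis
      by (simp only:)
  qed
  finally show ?thesis .
qed

section \<open>Distributions whose Fourier transform is a function\<close>

text \<open>A relation, as opposed to the chosen representative \<^const>\<open>fourier_fun\<close>, can be manipulated
  pointwise: sums, translates and cut-offs of representatives are again representatives.\<close>

definition has_fourier_fun :: "'a::euclidean_space distr \<Rightarrow> ('a \<Rightarrow> complex) \<Rightarrow> bool" where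
  "has_fourier_fun f g \<longleftrightarrow> f \<in> tempered \<and> locally_L2 g \<and> represents g (fourier_distr f)"

lemma has_fourier_fun_test:
  assumes "has_fourier_fun f g" "\<phi> \<in> test_fun"
  shows "f (fourier \<phi>) = (LINT x|lborel. g x * \<phi> x)"
  using assms test_fun_in_schwartz
  unfolding has_fourier_fun_def represents_def fourier_distr_def by fastforce

lemma has_fourier_funI:
  assumes "f \<in> tempered" "locally_L2 g"
    and "\<And>\<phi>. \<phi> \<in> test_fun \<Longrightarrow> f (fourier \<phi>) = (LINT x|lborel. g x * \<phi> x)"
  shows "has_fourier_fun f g"
  using assms test_fun_in_schwartz
  unfolding has_fourier_fun_def represents_def fourier_distr_def by auto

lemma has_fourier_fun_measurable:
  "has_fourier_fun f g \<Longrightarrow> g \<in> borel_measurable borel"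
  by (simp add: has_fourier_fun_def locally_L2_def)

lemma cmod_linear_square:
  "(cmod (a * z + b * w))\<^sup>2 \<le> 2 * (cmod a)\<^sup>2 * (cmod z)\<^sup>2 + 2 * (cmod b)\<^sup>2 * (cmod w)\<^sup>2"
proof -
  have "(cmod (a * z + b * w))\<^sup>2 \<le> (cmod (a * z) + cmod (b * w))\<^sup>2"
    by (intro power_mono norm_triangle_ineq) simp
  also have "\<dots> \<le> 2 * (cmod (a * z))\<^sup>2 + 2 * (cmod (b * w))\<^sup>2"
    using sum_squares_bound[of "cmod (a * z)" "cmod (b * w)"] by (simp add: power2_sum)
  finally show ?thesis
    by (simp add: norm_mult power_mult_distrib)
qed

text \<open>This crude form of Minkowski's inequality, with a factor \<open>2\<close>, suffices because the iteration
  in \<open>approximation_transfer\<close> contracts squared norms by \<open>1 / 4\<close>.\<close>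

lemma weighted_square_integrable_linear:
  fixes g g' :: "'a::euclidean_space \<Rightarrow> complex" and W :: "'a \<Rightarrow> real"
  assumes [measurable]: "g \<in> borel_measurable borel" "g' \<in> borel_measurable borel" "W \<in> borel_measurable borel"
    and W: "\<And>x. W x \<ge> 0"
    and g: "integrable lborel (\<lambda>x. W x * (cmod (g x))\<^sup>2)"
    and g': "integrable lborel (\<lambda>x. W x * (cmod (g' x))\<^sup>2)"
  shows "integrable lborel (\<lambda>x. W x * (cmod (a * g x + b * g' x))\<^sup>2)"
    and "(LINT x|lborel. W x * (cmod (a * g x + b * g' x))\<^sup>2)
      \<le> 2 * (cmod a)\<^sup>2 * (LINT x|lborel. W x * (cmod (g x))\<^sup>2)
        + 2 * (cmod b)\<^sup>2 * (LINT x|lborel. W x * (cmod (g' x))\<^sup>2)"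
proof -
  let ?B = "\<lambda>x. 2 * (cmod a)\<^sup>2 * (W x * (cmod (g x))\<^sup>2) + 2 * (cmod b)\<^sup>2 * (W x * (cmod (g' x))\<^sup>2)"
  have B: "integrable lborel ?B"
    by (intro Bochner_Integration.integrable_add integrable_mult_right g g')
  have le: "W x * (cmod (a * g x + b * g' x))\<^sup>2 \<le> ?B x" for x
    using mult_left_mono[OF cmod_linear_square[of a "g x" b "g' x"] W[of x]] by (simp add: algebra_simps)
  show int: "integrable lborel (\<lambda>x. W x * (cmod (a * g x + b * g' x))\<^sup>2)"
  proof (rule Bochner_Integration.integrable_bound[OF B])
    show "AE x in lborel. norm (W x * (cmod (a * g x + b * g' x))\<^sup>2) \<le> norm (?B x)"
    proof (rule AE_I2)
      fix x
      have "0 \<le> W x * (cmod (a * g x + b * g' x))\<^sup>2"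
        using W by simp
      with le[of x] show "norm (W x * (cmod (a * g x + b * g' x))\<^sup>2) \<le> norm (?B x)"
        unfolding real_norm_def by linarith
    qed
  qed measurable
  have "(LINT x|lborel. W x * (cmod (a * g x + b * g' x))\<^sup>2) \<le> (LINT x|lborel. ?B x)"
    by (rule integral_mono[OF int B le])
  also have "\<dots> = 2 * (cmod a)\<^sup>2 * (LINT x|lborel. W x * (cmod (g x))\<^sup>2)
        + 2 * (cmod b)\<^sup>2 * (LINT x|lborel. W x * (cmod (g' x))\<^sup>2)"
    by (subst Bochner_Integration.integral_add[OF integrable_mult_right[OF g] integrable_mult_right[OF g']])
      (simp only: integral_mult_right_zero)
  finally show "(LINT x|lborel. W x * (cmod (a * g x + b * g' x))\<^sup>2)
      \<le> 2 * (cmod a)\<^sup>2 * (LINT x|lborel. W x * (cmod (g x))\<^sup>2)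
        + 2 * (cmod b)\<^sup>2 * (LINT x|lborel. W x * (cmod (g' x))\<^sup>2)" .
qed

lemma locally_L2_linear:
  assumes "locally_L2 g" "locally_L2 g'"
  shows "locally_L2 (\<lambda>x. a * g x + b * g' x)"
proof -
  have [measurable]: "g \<in> borel_measurable borel" "g' \<in> borel_measurable borel"
    using assms by (auto simp: locally_L2_def)
  have "set_integrable lborel K (\<lambda>x. (cmod (a * g x + b * g' x))\<^sup>2)" if K: "compact K" for K
  proof -
    have [measurable]: "K \<in> sets borel"
      using K by (simp add: compact_imp_closed borel_closed)
    have "integrable lborel (\<lambda>x. indicator K x * (cmod (g x))\<^sup>2)"
      "integrable lborel (\<lambda>x. indicator K x * (cmod (g' x))\<^sup>2)"
      using assms K by (simp_all add: locally_L2_def set_integrable_def)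
    from weighted_square_integrable_linear(1)[OF _ _ _ _ this, of a b]
    show ?thesis
      by (simp add: set_integrable_def)
  qed
  then show ?thesis
    by (simp add: locally_L2_def)
qed

lemma has_fourier_fun_linear:
  assumes f: "has_fourier_fun f g" and f': "has_fourier_fun f' g'"
  shows "has_fourier_fun (\<lambda>\<phi>. a * f \<phi> + b * f' \<phi>) (\<lambda>x. a * g x + b * g' x)"
proof (rule has_fourier_funI)
  have L: "locally_L2 g" "locally_L2 g'"
    using assms by (auto simp: has_fourier_fun_def)
  show "locally_L2 (\<lambda>x. a * g x + b * g' x)"
    by (rule locally_L2_linear[OF L])
  show "(\<lambda>\<phi>. a * f \<phi> + b * f' \<phi>) \<in> tempered"
    using assms by (auto simp: has_fourier_fun_def intro: tempered_linear)
  fix \<phi> :: "'a \<Rightarrow> complex"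
  assume \<phi>: "\<phi> \<in> test_fun"
  note i = locally_L2_test_integrable[OF L(1) \<phi>] locally_L2_test_integrable[OF L(2) \<phi>]
  have "(LINT x|lborel. (a * g x + b * g' x) * \<phi> x)
      = (LINT x|lborel. a * (g x * \<phi> x) + b * (g' x * \<phi> x))"
    by (simp add: algebra_simps)
  also have "\<dots> = a * (LINT x|lborel. g x * \<phi> x) + b * (LINT x|lborel. g' x * \<phi> x)"
    by (subst Bochner_Integration.integral_add[OF integrable_mult_right[OF i(1)] integrable_mult_right[OF i(2)]])
      (simp only: integral_mult_right_zero)
  finally show "a * f (fourier \<phi>) + b * f' (fourier \<phi>) = (LINT x|lborel. (a * g x + b * g' x) * \<phi> x)"
    by (simp add: has_fourier_fun_test[OF f \<phi>] has_fourier_fun_test[OF f' \<phi>])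
qed

lemma has_fourier_fun_unique:
  assumes f: "has_fourier_fun f g" and f': "has_fourier_fun f g'"
  shows "AE x in lborel. g x = g' x"
proof -
  have h: "has_fourier_fun (\<lambda>\<phi>. 1 * f \<phi> + (-1) * f \<phi>) (\<lambda>x. 1 * g x + (-1) * g' x)"
    by (rule has_fourier_fun_linear[OF f f'])
  have "AE x in lborel. 1 * g x + (-1) * g' x = 0"
  proof (rule fundamental_lemma)
    show "locally_L2 (\<lambda>x. 1 * g x + (-1) * g' x)"
      using h by (simp only: has_fourier_fun_def)
    show "(LINT x|lborel. (1 * g x + (-1) * g' x) * \<phi> x) = 0" if "\<phi> \<in> test_fun" for \<phi>
      using has_fourier_fun_test[OF h that] by simp
  qed
  then show ?thesis by simp
qed

lemma locally_L2_affine: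
  fixes g :: "'a::euclidean_space \<Rightarrow> complex"
  assumes g: "locally_L2 g" and c: "c \<noteq> 0"
  shows "locally_L2 (\<lambda>x. k * (g (c *\<^sub>R x) * character v x))"
proof -
  have [measurable]: "g \<in> borel_measurable borel"
    using g by (simp add: locally_L2_def)
  have "set_integrable lborel K (\<lambda>x. (cmod (k * (g (c *\<^sub>R x) * character v x)))\<^sup>2)" if K: "compact K" for K
  proof -
    let ?K = "(\<lambda>x. c *\<^sub>R x) ` K"
    have K': "compact ?K" by (rule compact_scaling[OF K])
    then have [measurable]: "?K \<in> sets borel"
      by (simp add: compact_imp_closed borel_closed)
    have ind: "indicator ?K (c *\<^sub>R x) = (indicator K x :: real)" for x
      using c by (auto simp: indicator_def)
    have "integrable lborel (\<lambda>x. indicator ?K x * (cmod (g x))\<^sup>2)"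
      using g K' by (simp add: locally_L2_def set_integrable_def)
    then have "integrable lborel (\<lambda>x. indicator ?K (c *\<^sub>R x + 0) * (cmod (g (c *\<^sub>R x + 0)))\<^sup>2)"
      by (subst lborel_integral_affine(1)[OF c]) auto
    then have "integrable lborel (\<lambda>x. (cmod k)\<^sup>2 * (indicator K x * (cmod (g (c *\<^sub>R x)))\<^sup>2))"
      by (intro integrable_mult_right) (simp add: ind)
    then show ?thesis
      by (simp only: set_integrable_def norm_mult norm_character mult_1_right power_mult_distrib real_scaleR_def mult.left_commute)
  qed
  then show ?thesis
    by (simp add: locally_L2_def)
qed

text \<open>A translation multiplies the Fourier transform by a character and a dilation rescales it. In the
  proof the test function \<open>\<psi>\<close> is chosen such that its Fourier transform is that of \<open>\<phi>\<close> after the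
  substitution.\<close>

lemma has_fourier_fun_affine:
  fixes f :: "'a::euclidean_space distr"
  assumes f: "has_fourier_fun f g" and c: "c \<noteq> 0"
  shows "has_fourier_fun (\<lambda>\<phi>. k * f (\<lambda>x. \<phi> (c *\<^sub>R x + a))) (\<lambda>w. k * (g (c *\<^sub>R w) * character (- a) w))"
proof (rule has_fourier_funI)
  show "(\<lambda>\<phi>. k * f (\<lambda>x. \<phi> (c *\<^sub>R x + a))) \<in> tempered"
    using f c by (auto simp: has_fourier_fun_def intro: tempered_affine)
  show "locally_L2 (\<lambda>w. k * (g (c *\<^sub>R w) * character (- a) w))"
    using f by (intro locally_L2_affine c) (simp add: has_fourier_fun_def)
  fix \<phi> :: "'a \<Rightarrow> complex"
  assume \<phi>: "\<phi> \<in> test_fun"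
  have [measurable]: "g \<in> borel_measurable borel" "\<phi> \<in> borel_measurable borel"
    using has_fourier_fun_measurable[OF f] smooth_fun_measurable[OF test_fun_smooth[OF \<phi>]] by auto
  let ?m = "complex_of_real (\<bar>1 / c\<bar> ^ DIM('a))"
  let ?M = "complex_of_real (\<bar>c\<bar> ^ DIM('a))"
  let ?u = "- ((1 / c) *\<^sub>R a)"
  define \<psi> where "\<psi> y = \<phi> ((1 / c) *\<^sub>R y + 0) * (?m * character ?u y)" for y
  have mM: "?M * ?m = 1"
    using c by (simp add: power_mult_distrib[symmetric] abs_mult[symmetric] flip: of_real_mult)
  have \<psi>: "\<psi> \<in> test_fun"
    unfolding \<psi>_def using c by (intro test_fun_mult test_fun_affine \<phi> smooth_fun_cmult smooth_fun_character) auto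
  have [measurable]: "\<psi> \<in> borel_measurable borel"
    by (rule smooth_fun_measurable[OF test_fun_smooth[OF \<psi>]])
  have \<psi>_c: "\<psi> (c *\<^sub>R y + 0) = ?m * (\<phi> y * character (- a) y)" for y
  proof -
    have "\<psi> (c *\<^sub>R y + 0) = \<phi> y * (?m * character ?u (c *\<^sub>R y))"
      unfolding \<psi>_def using c by simp
    also have "character ?u (c *\<^sub>R y) = character (- a) y"
      using c by simp
    finally show ?thesis by (simp only: mult.left_commute)
  qed
  have "fourier \<psi> x = fourier \<phi> (c *\<^sub>R x + a)" for x
  proof -
    have "fourier \<psi> x = ?M * (LINT y|lborel. \<psi> (c *\<^sub>R y + 0) * character (- x) (c *\<^sub>R y + 0))"
      unfolding fourier_character
      by (subst lborel_integral_affine(2)[OF c, of _ 0]) (simp_all add: scaleR_conv_of_real)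
    also have "\<dots> = ?M * (LINT y|lborel. ?m * (\<phi> y * character (- (c *\<^sub>R x + a)) y))"
    proof -
      have "\<psi> (c *\<^sub>R y + 0) * character (- x) (c *\<^sub>R y + 0) = ?m * (\<phi> y * character (- (c *\<^sub>R x + a)) y)" for y
      proof -
        have "character (- x) (c *\<^sub>R y + 0) = character (- (c *\<^sub>R x)) y"
          by simp
        moreover have "character (- a) y * character (- (c *\<^sub>R x)) y = character (- (c *\<^sub>R x + a)) y"
          by (simp only: character_add) (simp add: add.commute)
        ultimately show ?thesis
          unfolding \<psi>_c by (simp only: mult.assoc)
      qed
      then show ?thesis by (simp only:)
    qed
    also have "\<dots> = (?M * ?m) * fourier \<phi> (c *\<^sub>R x + a)"
      unfolding fourier_character integral_mult_right_zero mult.assoc ..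
    finally show ?thesis
      unfolding mM by simp
  qed
  then have "(\<lambda>x. fourier \<phi> (c *\<^sub>R x + a)) = fourier \<psi>"
    by auto
  then have "k * f (\<lambda>x. fourier \<phi> (c *\<^sub>R x + a)) = k * (LINT y|lborel. g y * \<psi> y)"
    using has_fourier_fun_test[OF f \<psi>] by simp
  also have "(LINT y|lborel. g y * \<psi> y) = ?M * (LINT y|lborel. g (c *\<^sub>R y + 0) * \<psi> (c *\<^sub>R y + 0))"
    by (subst lborel_integral_affine(2)[OF c, of _ 0]) (simp_all add: scaleR_conv_of_real)
  also have "\<dots> = ?M * (LINT y|lborel. ?m * (g (c *\<^sub>R y) * character (- a) y * \<phi> y))"
    unfolding \<psi>_c by (simp only: add_0_right mult_ac)
  also have "\<dots> = (?M * ?m) * (LINT y|lborel. g (c *\<^sub>R y) * character (- a) y * \<phi> y)"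
    unfolding integral_mult_right_zero mult.assoc ..
  also have "k * \<dots> = (LINT y|lborel. k * (g (c *\<^sub>R y) * character (- a) y * \<phi> y))"
    unfolding mM mult_1_left integral_mult_right_zero ..
  finally show "k * f (\<lambda>x. fourier \<phi> (c *\<^sub>R x + a)) = (LINT w|lborel. k * (g (c *\<^sub>R w) * character (- a) w) * \<phi> w)"
    by (simp only: mult.assoc)
qed

text \<open>The distribution is given by the inverse Fourier transform of \<open>G\<close>, a bounded function. The
  inversion formula for test functions identifies its Fourier transform.\<close>

lemma has_fourier_fun_exists:
  fixes G :: "'a::euclidean_space \<Rightarrow> complex"
  assumes G: "locally_L2 G" and supp: "\<And>x. norm x > R \<Longrightarrow> G x = 0"
  obtains f where "has_fourier_fun f G"
proof -
  have [measurable]: "G \<in> borel_measurable borel"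
    using G by (simp add: locally_L2_def)
  have "(\<lambda>x. indicator (cball 0 R) x *\<^sub>R G x) = G"
    using supp by (auto simp: indicator_def fun_eq_iff not_le)
  then have intG: "integrable lborel G"
    using locally_L2_set_integrable[OF G compact_cball, of 0 R] by (simp add: set_integrable_def)
  let ?p = "complex_of_real ((2 * pi) ^ DIM('a))"
  define F where "F x = (1 / ?p) * (LINT w|lborel. G w * character (1 *\<^sub>R w) x)" for x
  let ?f = "\<lambda>\<phi>. if \<phi> \<in> schwartz then LINT x|lborel. F x * \<phi> x else 0"
  have "(\<lambda>x. LINT w|lborel. G w * character (1 *\<^sub>R w) x) \<in> borel_measurable borel"
    by measurable
  then have F: "F \<in> borel_measurable borel"
    unfolding F_def by (intro borel_measurable_times) simp_all
  have "cmod (F x) \<le> cmod (1 / ?p) * (LINT w|lborel. cmod (G w))" for x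
  proof -
    have "cmod (LINT w|lborel. G w * character (1 *\<^sub>R w) x) \<le> (LINT w|lborel. cmod (G w * character (1 *\<^sub>R w) x))"
      by (rule integral_norm_bound)
    then show ?thesis
      unfolding F_def norm_mult[of "1 / ?p"] by (intro mult_left_mono) (simp_all add: norm_mult)
  qed
  then have "?f \<in> tempered"
    by (rule tempered_of_bounded_fun[OF F])
  moreover have "?f (fourier \<phi>) = (LINT x|lborel. G x * \<phi> x)" if \<phi>: "\<phi> \<in> test_fun" for \<phi>
  proof -
    have p: "?p \<noteq> 0" by simp
    have "?f (fourier \<phi>) = (LINT x|lborel. (1 / ?p) * (fourier \<phi> x * (LINT w|lborel. G w * character (1 *\<^sub>R w) x)))"
      using fourier_test_schwartz[OF \<phi>] by (simp add: F_def mult_ac)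
    also have "\<dots> = (1 / ?p) * (LINT x|lborel. fourier \<phi> x * (LINT w|lborel. G w * character (1 *\<^sub>R w) x))"
      by (rule integral_mult_right_zero)
    also have "(LINT x|lborel. fourier \<phi> x * (LINT w|lborel. G w * character (1 *\<^sub>R w) x))
        = (LINT w|lborel. G w * (LINT x|lborel. fourier \<phi> x * character (1 *\<^sub>R w) x))"
      by (rule fubini_bounded_kernel[OF schwartz_integrable[OF fourier_test_schwartz[OF \<phi>]] intG character_measurable_pair]) simp
    also have "\<dots> = (LINT w|lborel. ?p * (G w * \<phi> w))"
      by (simp only: scaleR_one fourier_inversion[OF \<phi>] mult.left_commute)
    also have "(1 / ?p) * \<dots> = (LINT w|lborel. G w * \<phi> w)"
      unfolding integral_mult_right_zero using p by (simp only: mult.assoc[symmetric] times_divide_eq_left) simp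
    finally show ?thesis .
  qed
  ultimately have "has_fourier_fun ?f G"
    by (intro has_fourier_funI G)
  then show ?thesis by (rule that)
qed

section \<open>The Sobolev spaces\<close>

text \<open>The square of the Sobolev norm, as a function of the Fourier transform.\<close>

definition energy :: "real \<Rightarrow> ('a::euclidean_space \<Rightarrow> complex) \<Rightarrow> real" where
  "energy s g = (LINT w|lborel. (1 + norm w) powr (2 * s) * (cmod (g w))\<^sup>2)"

definition finite_energy :: "real \<Rightarrow> ('a::euclidean_space \<Rightarrow> complex) \<Rightarrow> bool" where
  "finite_energy s g \<longleftrightarrow> integrable lborel (\<lambda>w. (1 + norm w) powr (2 * s) * (cmod (g w))\<^sup>2)"

lemma energy_nonneg: "energy s g \<ge> 0"
  unfolding energy_def by (rule integral_nonneg_AE) auto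

lemma fourier_fun_AE:
  assumes "has_fourier_fun f g"
  shows "has_fourier_fun f (fourier_fun f)" "AE w in lborel. fourier_fun f w = g w"
proof -
  have "locally_L2 (fourier_fun f) \<and> represents (fourier_fun f) (fourier_distr f)"
    unfolding fourier_fun_def by (rule someI[of _ g]) (use assms in \<open>simp add: has_fourier_fun_def\<close>)
  then show "has_fourier_fun f (fourier_fun f)"
    using assms by (simp add: has_fourier_fun_def)
  then show "AE w in lborel. fourier_fun f w = g w"
    by (rule has_fourier_fun_unique[OF _ assms])
qed

lemma energy_fourier_fun:
  assumes "has_fourier_fun f g"
  shows "finite_energy s (fourier_fun f) \<longleftrightarrow> finite_energy s g" "energy s (fourier_fun f) = energy s g"
proof -
  have [measurable]: "g \<in> borel_measurable borel" "fourier_fun f \<in> borel_measurable borel"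
    using has_fourier_fun_measurable assms fourier_fun_AE(1) by blast+
  have ae: "AE w in lborel. (1 + norm w) powr (2 * s) * (cmod (fourier_fun f w))\<^sup>2
      = (1 + norm w) powr (2 * s) * (cmod (g w))\<^sup>2"
    using fourier_fun_AE(2)[OF assms] by eventually_elim simp
  show "finite_energy s (fourier_fun f) \<longleftrightarrow> finite_energy s g"
    unfolding finite_energy_def by (rule integrable_cong_AE[OF _ _ ae]) measurable
  show "energy s (fourier_fun f) = energy s g"
    unfolding energy_def by (rule integral_cong_AE[OF _ _ ae]) measurable
qed

lemma W2_I: "has_fourier_fun f g \<Longrightarrow> finite_energy s g \<Longrightarrow> f \<in> W2 s"
  using energy_fourier_fun(1)[of f g s] unfolding W2_def finite_energy_def has_fourier_fun_def by auto

lemma W2_E: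
  assumes "f \<in> W2 s"
  obtains g where "has_fourier_fun f g" "finite_energy s g"
proof -
  obtain g where g: "has_fourier_fun f g"
    using assms unfolding W2_def has_fourier_fun_def by blast
  moreover have "finite_energy s g"
    using assms energy_fourier_fun(1)[OF g, of s] unfolding W2_def finite_energy_def by blast
  ultimately show ?thesis using that by blast
qed

lemma W2_norm_square:
  assumes "has_fourier_fun f g"
  shows "(W2_norm s f)\<^sup>2 = energy s g"
proof -
  have "W2_norm s f = sqrt (energy s (fourier_fun f))"
    by (simp add: W2_norm_def energy_def)
  then show ?thesis
    by (simp add: energy_fourier_fun(2)[OF assms] energy_nonneg)
qed

lemma W2_norm_nonneg: "W2_norm s f \<ge> 0"
  unfolding W2_norm_def by (intro real_sqrt_ge_zero integral_nonneg_AE) auto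

lemma energy_linear:
  assumes [measurable]: "g \<in> borel_measurable borel" "g' \<in> borel_measurable borel"
    and "finite_energy s g" "finite_energy s g'"
  shows "finite_energy s (\<lambda>x. a * g x + b * g' x)"
    and "energy s (\<lambda>x. a * g x + b * g' x) \<le> 2 * (cmod a)\<^sup>2 * energy s g + 2 * (cmod b)\<^sup>2 * energy s g'"
  using weighted_square_integrable_linear[of g g' "\<lambda>w. (1 + norm w) powr (2 * s)" a b] assms
  unfolding finite_energy_def energy_def by simp_all

lemma W2_linear:
  assumes "f \<in> W2 s" "f' \<in> W2 s"
  shows "(\<lambda>\<phi>. a * f \<phi> + b * f' \<phi>) \<in> W2 s"
proof -
  obtain g where g: "has_fourier_fun f g" "finite_energy s g"
    using W2_E[OF assms(1)] .
  obtain g' where g': "has_fourier_fun f' g'" "finite_energy s g'"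
    using W2_E[OF assms(2)] .
  show ?thesis
    using has_fourier_fun_linear[OF g(1) g'(1)]
      energy_linear(1)[OF has_fourier_fun_measurable[OF g(1)] has_fourier_fun_measurable[OF g'(1)] g(2) g'(2)]
    by (rule W2_I)
qed

text \<open>Multiplying \<open>g\<close> by a bounded function, or cutting it off to a region where one weight dominates
  another, both reduce to a pointwise comparison.\<close>

lemma energy_le:
  fixes g G :: "'a::euclidean_space \<Rightarrow> complex"
  assumes [measurable]: "G \<in> borel_measurable borel"
    and g: "finite_energy s g"
    and le: "\<And>w. (1 + norm w) powr (2 * t) * (cmod (G w))\<^sup>2 \<le> M * ((1 + norm w) powr (2 * s) * (cmod (g w))\<^sup>2)"
  shows "finite_energy t G" "energy t G \<le> M * energy s g"
proof -
  have M: "integrable lborel (\<lambda>w. M * ((1 + norm w) powr (2 * s) * (cmod (g w))\<^sup>2))"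
    using g unfolding finite_energy_def by (rule integrable_mult_right)
  have G: "integrable lborel (\<lambda>w. (1 + norm w) powr (2 * t) * (cmod (G w))\<^sup>2)"
  proof (rule Bochner_Integration.integrable_bound[OF M])
    show "AE w in lborel. norm ((1 + norm w) powr (2 * t) * (cmod (G w))\<^sup>2)
        \<le> norm (M * ((1 + norm w) powr (2 * s) * (cmod (g w))\<^sup>2))"
    proof (rule AE_I2)
      fix w :: 'a
      have "0 \<le> (1 + norm w) powr (2 * t) * (cmod (G w))\<^sup>2" by simp
      with le[of w] show "norm ((1 + norm w) powr (2 * t) * (cmod (G w))\<^sup>2)
        \<le> norm (M * ((1 + norm w) powr (2 * s) * (cmod (g w))\<^sup>2))"
        unfolding real_norm_def by linarith
    qed
  qed measurable
  then show "finite_energy t G" by (simp add: finite_energy_def)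
  have "energy t G \<le> (LINT w|lborel. M * ((1 + norm w) powr (2 * s) * (cmod (g w))\<^sup>2))"
    unfolding energy_def by (rule integral_mono[OF G M le])
  then show "energy t G \<le> M * energy s g"
    unfolding energy_def by simp
qed

lemma energy_mono:
  assumes "g \<in> borel_measurable borel" "finite_energy s g" "t \<le> s"
  shows "finite_energy t g" "energy t g \<le> energy s g"
proof -
  have "(1 + norm w) powr (2 * t) * (cmod (g w))\<^sup>2 \<le> 1 * ((1 + norm w) powr (2 * s) * (cmod (g w))\<^sup>2)" for w
    using assms(3) by (simp add: mult_right_mono powr_mono)
  from energy_le[OF assms(1,2) this] show "finite_energy t g" "energy t g \<le> energy s g"
    by simp_all
qed

lemma W2_mono: "t \<le> s \<Longrightarrow> W2 s \<subseteq> W2 t"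
  by (meson W2_E W2_I energy_mono(1) has_fourier_fun_measurable subsetI)

lemma W2_norm_mono:
  assumes "f \<in> W2 s" "t \<le> s"
  shows "W2_norm t f \<le> W2_norm s f"
proof -
  obtain g where g: "has_fourier_fun f g" "finite_energy s g"
    using W2_E[OF assms(1)] .
  have "(W2_norm t f)\<^sup>2 \<le> (W2_norm s f)\<^sup>2"
    unfolding W2_norm_square[OF g(1)] by (rule energy_mono(2)[OF has_fourier_fun_measurable[OF g(1)] g(2) assms(2)])
  then show ?thesis
    by (rule power2_le_imp_le) (rule W2_norm_nonneg)
qed

text \<open>For positive exponents the weight has to be bounded from above by the rescaled one, for negative
  exponents from below.\<close>

lemma weight_powr_scale:
  assumes "c \<noteq> 0"
  obtains M where "\<And>w::'a::euclidean_space. (1 + norm w) powr p \<le> M * (1 + norm (c *\<^sub>R w)) powr p"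
proof (cases "p \<ge> 0")
  case True
  obtain K where K: "K > 0" "\<And>x::'a. 1 + norm x \<le> K * (1 + norm (c *\<^sub>R x + 0))"
    using weight_affine[OF assms] by blast
  show ?thesis
  proof
    fix w :: 'a
    have "(1 + norm w) powr p \<le> (K * (1 + norm (c *\<^sub>R w + 0))) powr p"
      using True by (intro powr_mono2 K) auto
    also have "\<dots> = K powr p * (1 + norm (c *\<^sub>R w)) powr p"
      using K(1) by (subst powr_mult) auto
    finally show "(1 + norm w) powr p \<le> K powr p * (1 + norm (c *\<^sub>R w)) powr p" .
  qed
next
  case False
  obtain K where K: "K > 0" "\<And>x::'a. 1 + norm x \<le> K * (1 + norm ((1 / c) *\<^sub>R x + 0))"
    using weight_affine[of "1 / c"] assms by (metis divide_eq_0_iff zero_neq_one)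
  show ?thesis
  proof
    fix w :: 'a
    have "1 + norm (c *\<^sub>R w) \<le> K * (1 + norm w)"
      using K(2)[of "c *\<^sub>R w"] assms by simp
    then have "(K * (1 + norm w)) powr p \<le> (1 + norm (c *\<^sub>R w)) powr p"
      using False by (intro powr_mono2') (auto intro: add_pos_nonneg)
    moreover have "(K * (1 + norm w)) powr p = K powr p * (1 + norm w) powr p"
      using K(1) by (subst powr_mult) auto
    moreover have "K powr p > 0" using K(1) by simp
    ultimately show "(1 + norm w) powr p \<le> (1 / K powr p) * (1 + norm (c *\<^sub>R w)) powr p"
      by (simp add: field_simps)
  qed
qed

lemma W2_affine:
  fixes f :: "'a::euclidean_space distr"
  assumes "f \<in> W2 s" "c \<noteq> 0"
  shows "(\<lambda>\<phi>. k * f (\<lambda>x. \<phi> (c *\<^sub>R x + a))) \<in> W2 s"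
proof -
  obtain g where g: "has_fourier_fun f g" "finite_energy s g"
    using W2_E[OF assms(1)] .
  have [measurable]: "g \<in> borel_measurable borel"
    by (rule has_fourier_fun_measurable[OF g(1)])
  obtain M where M: "\<And>w::'a. (1 + norm w) powr (2 * s) \<le> M * (1 + norm (c *\<^sub>R w)) powr (2 * s)"
    using weight_powr_scale[OF assms(2)] by blast
  have fin: "finite_energy s (\<lambda>w. g (c *\<^sub>R w))"
    unfolding finite_energy_def
  proof (rule Bochner_Integration.integrable_bound)
    have "integrable lborel (\<lambda>w. (1 + norm (c *\<^sub>R w + 0)) powr (2 * s) * (cmod (g (c *\<^sub>R w + 0)))\<^sup>2)"
      using g(2) unfolding finite_energy_def by (subst lborel_integral_affine(1)[OF assms(2)]) simp_all
    then show "integrable lborel (\<lambda>w. M * ((1 + norm (c *\<^sub>R w)) powr (2 * s) * (cmod (g (c *\<^sub>R w)))\<^sup>2))"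
      by (intro integrable_mult_right) simp
    show "AE w in lborel. norm ((1 + norm w) powr (2 * s) * (cmod (g (c *\<^sub>R w)))\<^sup>2)
        \<le> norm (M * ((1 + norm (c *\<^sub>R w)) powr (2 * s) * (cmod (g (c *\<^sub>R w)))\<^sup>2))"
    proof (rule AE_I2)
      fix w :: 'a
      have "(1 + norm w) powr (2 * s) * (cmod (g (c *\<^sub>R w)))\<^sup>2
          \<le> M * ((1 + norm (c *\<^sub>R w)) powr (2 * s) * (cmod (g (c *\<^sub>R w)))\<^sup>2)"
        using mult_right_mono[OF M[of w], of "(cmod (g (c *\<^sub>R w)))\<^sup>2"] by (simp add: mult.assoc)
      moreover have "0 \<le> (1 + norm w) powr (2 * s) * (cmod (g (c *\<^sub>R w)))\<^sup>2"
        by simp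
      ultimately show "norm ((1 + norm w) powr (2 * s) * (cmod (g (c *\<^sub>R w)))\<^sup>2)
        \<le> norm (M * ((1 + norm (c *\<^sub>R w)) powr (2 * s) * (cmod (g (c *\<^sub>R w)))\<^sup>2))"
        unfolding real_norm_def by linarith
    qed
  qed measurable
  have "finite_energy s (\<lambda>w. k * (g (c *\<^sub>R w) * character (- a) w))"
  proof (rule energy_le(1)[OF _ fin])
    show "(1 + norm w) powr (2 * s) * (cmod (k * (g (c *\<^sub>R w) * character (- a) w)))\<^sup>2
        \<le> (cmod k)\<^sup>2 * ((1 + norm w) powr (2 * s) * (cmod (g (c *\<^sub>R w)))\<^sup>2)" for w
      by (simp only: norm_mult norm_character mult_1_right power_mult_distrib mult.left_commute order_refl)
  qed measurable
  then show ?thesis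
    by (rule W2_I[OF has_fourier_fun_affine[OF g(1) assms(2)]])
qed

section \<open>Shift-invariant spaces\<close>

lemma W2_translate: "f \<in> W2 s \<Longrightarrow> translate \<alpha> f \<in> W2 s"
  using W2_affine[of f s 1 1 \<alpha>] by (simp add: translate_def)

lemma W2_dilate:
  assumes "f \<in> W2 s" "h > 0"
  shows "dilate h f \<in> W2 s"
  using W2_affine[OF assms(1), of h "of_real (h ^ DIM('a))" 0] assms(2) by (simp add: dilate_def)

lemma has_fourier_fun_zero: "has_fourier_fun (\<lambda>\<phi>. 0) (\<lambda>w::'a::euclidean_space. 0)"
  by (rule has_fourier_funI) (auto simp: locally_L2_def set_integrable_def intro!: temperedI)

lemma W2_zero: "(\<lambda>\<phi>. 0) \<in> W2 s"
  by (rule W2_I[OF has_fourier_fun_zero]) (simp add: finite_energy_def)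

lemma W2_diff: "f \<in> W2 s \<Longrightarrow> g \<in> W2 s \<Longrightarrow> (\<lambda>\<phi>. f \<phi> - g \<phi>) \<in> W2 s"
  using W2_linear[of f s g 1 "-1"] by simp

text \<open>Being among the spaces that are intersected in \<^const>\<open>SI_space\<close>, the whole space ensures that
  \<^const>\<open>SI_space\<close> consists of elements of \<open>W2 s\<close>.\<close>

lemma closed_subspace_whole: "closed_subspace_W2 s (W2 s)"
  unfolding closed_subspace_W2_def
  using W2_linear[of _ s _ 1 1] W2_linear[of _ s _ _ 0] W2_zero by auto

lemma shift_invariant_whole: "shift_invariant (W2 s)"
  unfolding shift_invariant_def by (simp add: W2_translate)

lemma SI_space_subset: "\<Phi> \<subseteq> W2 s \<Longrightarrow> SI_space s \<Phi> \<subseteq> W2 s"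
  unfolding SI_space_def using closed_subspace_whole shift_invariant_whole by blast

lemma SI_space_zero: "(\<lambda>\<phi>. 0) \<in> SI_space s \<Phi>"
  unfolding SI_space_def closed_subspace_W2_def by blast

lemma SI_space_add: "f \<in> SI_space s \<Phi> \<Longrightarrow> g \<in> SI_space s \<Phi> \<Longrightarrow> (\<lambda>\<phi>. f \<phi> + g \<phi>) \<in> SI_space s \<Phi>"
  unfolding SI_space_def closed_subspace_W2_def by blast

text \<open>Convergence in the stronger norm implies convergence in the weaker one.\<close>

lemma closed_subspace_restrict:
  assumes V: "closed_subspace_W2 t V" and ts: "t \<le> s"
  shows "closed_subspace_W2 s (V \<inter> W2 s)"
proof -
  have "f \<in> V" if F: "\<And>n. F n \<in> V \<inter> W2 s" and f: "f \<in> W2 s" and lim: "(\<lambda>n. W2_dist s (F n) f) \<longlonglongrightarrow> 0"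
    for F :: "nat \<Rightarrow> 'a distr" and f
  proof -
    have "(\<lambda>n. W2_dist t (F n) f) \<longlonglongrightarrow> 0"
    proof (rule tendsto_sandwich[OF _ _ tendsto_const lim])
      show "\<forall>\<^sub>F n in sequentially. 0 \<le> W2_dist t (F n) f"
        by (simp add: W2_dist_def W2_norm_nonneg)
      show "\<forall>\<^sub>F n in sequentially. W2_dist t (F n) f \<le> W2_dist s (F n) f"
        unfolding W2_dist_def using F f ts by (intro always_eventually allI W2_norm_mono W2_diff) auto
    qed
    moreover have "f \<in> W2 t" using f W2_mono[OF ts] by blast
    ultimately show "f \<in> V"
      using V F unfolding closed_subspace_W2_def by blast
  qed
  moreover have "(\<lambda>\<phi>. f \<phi> + g \<phi>) \<in> V \<inter> W2 s" if "f \<in> V \<inter> W2 s" "g \<in> V \<inter> W2 s" for f g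
    using V that W2_linear[of f s g 1 1] unfolding closed_subspace_W2_def by auto
  moreover have "(\<lambda>\<phi>. c * f \<phi>) \<in> V \<inter> W2 s" if "f \<in> V \<inter> W2 s" for c f
    using V that W2_linear[of f s f c 0] unfolding closed_subspace_W2_def by auto
  moreover have "(\<lambda>\<phi>. 0) \<in> V \<inter> W2 s"
    using V W2_zero unfolding closed_subspace_W2_def by blast
  ultimately show ?thesis
    unfolding closed_subspace_W2_def by blast
qed

lemma SI_space_mono:
  assumes "\<Phi> \<subseteq> W2 s" "t \<le> s"
  shows "SI_space s \<Phi> \<subseteq> SI_space t \<Phi>"
proof -
  have "SI_space s \<Phi> \<subseteq> V" if V: "closed_subspace_W2 t V" "shift_invariant V" "\<Phi> \<subseteq> V" for V
  proof -
    have "shift_invariant (V \<inter> W2 s)"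
      using V(2) unfolding shift_invariant_def by (auto simp: W2_translate)
    moreover have "\<Phi> \<subseteq> V \<inter> W2 s"
      using V(3) assms(1) by blast
    ultimately show ?thesis
      using closed_subspace_restrict[OF V(1) assms(2)] unfolding SI_space_def by blast
  qed
  then show ?thesis
    unfolding SI_space_def[of t] by blast
qed

section \<open>Transfer of approximation to weaker norms\<close>

text \<open>The error \<open>e\<close> of an approximation \<open>g1\<close> of \<open>f\<close> in the norm of order \<open>s\<close> is cut at frequency
  \<open>\<rho>\<close>. Its high part is smaller by \<open>\<rho> powr (t - s)\<close> in the norm of order \<open>t\<close>, as desired. Its low
  part \<open>e0\<close> need not be small in that norm; but it lies in \<open>W2 k\<close> with at most half the norm of
  \<open>f\<close>, so that it can be approximated in turn. Iteration yields a geometric series, and the term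
  \<open>(1 / 2) ^ N\<close> accounts for the low part that is left after \<open>N\<close> rounds. The approximations
  of all rounds are added up, for which \<open>S\<close> has to be closed under addition.\<close>

lemma approximation_transfer:
  fixes S :: "'a::euclidean_space distr set"
  assumes S: "S \<subseteq> W2 s" "(\<lambda>\<phi>. 0) \<in> S" "\<And>f g. f \<in> S \<Longrightarrow> g \<in> S \<Longrightarrow> (\<lambda>\<phi>. f \<phi> + g \<phi>) \<in> S"
    and ts: "t \<le> s" "s < k"
    and c: "c \<ge> 0" and \<rho>: "\<rho> > 1" and small: "c * \<rho> powr (k - s) \<le> 1 / 2"
    and approx: "\<And>f. f \<in> W2 k \<Longrightarrow> \<exists>g\<in>S. W2_dist s f g \<le> c * W2_norm k f"
    and f: "f \<in> W2 k"
  shows "\<exists>g\<in>S. (W2_dist t f g)\<^sup>2 \<le> (4 * (c * \<rho> powr (t - s))\<^sup>2 + (1 / 2) ^ N) * (W2_norm k f)\<^sup>2"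
  using f
proof (induction N arbitrary: f)
  case 0
  have "(W2_norm t f)\<^sup>2 \<le> 1 * (W2_norm k f)\<^sup>2"
    using W2_norm_mono[OF 0, of t] ts by (simp add: W2_norm_nonneg power_mono)
  also have "\<dots> \<le> (4 * (c * \<rho> powr (t - s))\<^sup>2 + (1 / 2) ^ 0) * (W2_norm k f)\<^sup>2"
    by (intro mult_right_mono) simp_all
  finally show ?case
    using S(2) by (intro bexI[of _ "\<lambda>\<phi>. 0"]) (simp_all add: W2_dist_def)
next
  case (Suc N)
  let ?A = "c * \<rho> powr (t - s)"
  obtain g1 where g1: "g1 \<in> S" "W2_dist s f g1 \<le> c * W2_norm k f"
    using approx[OF Suc.prems] by blast
  define e where "e = (\<lambda>\<phi>. f \<phi> - g1 \<phi>)"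
  have "f \<in> W2 s"
    using Suc.prems W2_mono[of s k] ts by auto
  then have "e \<in> W2 s"
    unfolding e_def using g1(1) S(1) by (intro W2_diff) auto
  then obtain E where E: "has_fourier_fun e E" "finite_energy s E"
    by (rule W2_E)
  have [measurable]: "E \<in> borel_measurable borel"
    by (rule has_fourier_fun_measurable[OF E(1)])
  have "(W2_dist s f g1)\<^sup>2 \<le> (c * W2_norm k f)\<^sup>2"
    using g1(2) by (intro power_mono) (simp_all add: W2_dist_def W2_norm_nonneg)
  then have energyE: "energy s E \<le> c\<^sup>2 * (W2_norm k f)\<^sup>2"
    using W2_norm_square[OF E(1), of s] by (simp add: W2_dist_def e_def power_mult_distrib)
  \<comment> \<open>Relative to the weight of order \<open>s\<close>, the weight of order \<open>k\<close> increases with \<open>norm w\<close>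
    and that of order \<open>t\<close> decreases; both are therefore controlled by their value at
    \<open>1 + norm w = \<rho>\<close>, the former on the low and the latter on the high frequencies.\<close>
  define L where "L w = (if 1 + norm w < \<rho> then E w else 0)" for w
  define H where "H w = (if 1 + norm w < \<rho> then 0 else E w)" for w
  have [measurable]: "L \<in> borel_measurable borel" "H \<in> borel_measurable borel"
    unfolding L_def H_def by measurable
  have weight: "(1 + norm w) powr (2 * a) \<le> (\<rho> powr (a - s))\<^sup>2 * (1 + norm w) powr (2 * s)"
    if "s \<le> a \<and> 1 + norm w < \<rho> \<or> a \<le> s \<and> \<rho> \<le> 1 + norm w" for a and w :: 'a
  proof -
    have pos: "1 + norm w > 0" by (rule add_pos_nonneg) auto
    have "(1 + norm w) powr (2 * (a - s)) \<le> \<rho> powr (2 * (a - s))"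
      using that \<rho> pos by (auto intro: powr_mono2 powr_mono2')
    then have "(1 + norm w) powr (2 * (a - s)) * (1 + norm w) powr (2 * s) \<le> \<rho> powr (2 * (a - s)) * (1 + norm w) powr (2 * s)"
      by (rule mult_right_mono) simp
    moreover have "(1 + norm w) powr (2 * (a - s)) * (1 + norm w) powr (2 * s) = (1 + norm w) powr (2 * a)"
      by (simp add: powr_add[symmetric] algebra_simps)
    moreover have "\<rho> powr (2 * (a - s)) = (\<rho> powr (a - s))\<^sup>2"
      by (simp add: power2_eq_square powr_add[symmetric])
    ultimately show ?thesis by simp
  qed
  have low: "(1 + norm w) powr (2 * k) * (cmod (L w))\<^sup>2
      \<le> (\<rho> powr (k - s))\<^sup>2 * ((1 + norm w) powr (2 * s) * (cmod (E w))\<^sup>2)" for w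
    using weight[of k w] ts mult_right_mono[OF weight[of k w], of "(cmod (E w))\<^sup>2"]
    by (cases "1 + norm w < \<rho>") (simp_all add: L_def mult.assoc)
  have high: "(1 + norm w) powr (2 * t) * (cmod (H w))\<^sup>2
      \<le> (\<rho> powr (t - s))\<^sup>2 * ((1 + norm w) powr (2 * s) * (cmod (E w))\<^sup>2)" for w
    using weight[of t w] ts mult_right_mono[OF weight[of t w], of "(cmod (E w))\<^sup>2"]
    by (cases "1 + norm w < \<rho>") (simp_all add: H_def mult.assoc not_less)
  have Lk: "finite_energy k L" and Lk': "energy k L \<le> (\<rho> powr (k - s))\<^sup>2 * energy s E"
    by (rule energy_le[OF _ E(2) low]; simp)+
  have Ht: "finite_energy t H" and Ht': "energy t H \<le> (\<rho> powr (t - s))\<^sup>2 * energy s E"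
    by (rule energy_le[OF _ E(2) high]; simp)+
  have "locally_L2 L"
    unfolding locally_L2_def
  proof (intro conjI allI impI)
    fix K :: "'a set"
    assume K: "compact K"
    have "set_integrable lborel K (\<lambda>x. (cmod (E x))\<^sup>2)"
      using E(1) K by (simp add: has_fourier_fun_def locally_L2_def)
    then show "set_integrable lborel K (\<lambda>x. (cmod (L x))\<^sup>2)"
      unfolding set_integrable_def
      by (rule Bochner_Integration.integrable_bound)
        (use K in \<open>auto simp: L_def compact_imp_closed borel_closed\<close>)
  qed simp
  then obtain e0 where e0: "has_fourier_fun e0 L"
    by (rule has_fourier_fun_exists[of L \<rho>]) (simp add: L_def)
  have e0_k: "e0 \<in> W2 k"
    by (rule W2_I[OF e0 Lk])
  have "(W2_norm k e0)\<^sup>2 \<le> (\<rho> powr (k - s))\<^sup>2 * (c\<^sup>2 * (W2_norm k f)\<^sup>2)"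
    unfolding W2_norm_square[OF e0] using Lk' mult_left_mono[OF energyE, of "(\<rho> powr (k - s))\<^sup>2"] by simp
  also have "\<dots> = (c * \<rho> powr (k - s))\<^sup>2 * (W2_norm k f)\<^sup>2"
    by (simp add: power_mult_distrib mult_ac)
  also have "\<dots> \<le> (1 / 2)\<^sup>2 * (W2_norm k f)\<^sup>2"
    using small c by (intro mult_right_mono power_mono) auto
  finally have e0_norm: "(W2_norm k e0)\<^sup>2 \<le> (W2_norm k f)\<^sup>2 / 4"
    by (simp add: power2_eq_square)
  obtain g2 where g2: "g2 \<in> S" "(W2_dist t e0 g2)\<^sup>2 \<le> (4 * ?A\<^sup>2 + (1 / 2) ^ N) * (W2_norm k e0)\<^sup>2"
    using Suc.IH[OF e0_k] by blast
  define u where "u = (\<lambda>\<phi>. e0 \<phi> - g2 \<phi>)"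
  have "e0 \<in> W2 t" "g2 \<in> W2 t"
    using e0_k g2(1) S(1) W2_mono[of t k] W2_mono[of t s] ts by auto
  then have "u \<in> W2 t"
    unfolding u_def by (rule W2_diff)
  then obtain U where U: "has_fourier_fun u U" "finite_energy t U"
    by (rule W2_E)
  have "has_fourier_fun (\<lambda>\<phi>. 1 * e \<phi> + (-1) * e0 \<phi>) (\<lambda>w. 1 * E w + (-1) * L w)"
    by (rule has_fourier_fun_linear[OF E(1) e0])
  also have "(\<lambda>w. 1 * E w + (-1) * L w) = H"
    by (auto simp: L_def H_def)
  finally have "has_fourier_fun (\<lambda>\<phi>. 1 * (1 * e \<phi> + (-1) * e0 \<phi>) + 1 * u \<phi>) (\<lambda>w. 1 * H w + 1 * U w)"
    by (rule has_fourier_fun_linear[OF _ U(1)])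
  moreover have "(\<lambda>\<phi>. 1 * (1 * e \<phi> + (-1) * e0 \<phi>) + 1 * u \<phi>) = (\<lambda>\<phi>. f \<phi> - (g1 \<phi> + g2 \<phi>))"
    by (auto simp: e_def u_def)
  ultimately have "(W2_dist t f (\<lambda>\<phi>. g1 \<phi> + g2 \<phi>))\<^sup>2 = energy t (\<lambda>w. 1 * H w + 1 * U w)"
    unfolding W2_dist_def by (simp only: W2_norm_square)
  also have "\<dots> \<le> 2 * (cmod 1)\<^sup>2 * energy t H + 2 * (cmod 1)\<^sup>2 * energy t U"
    by (rule energy_linear(2)[OF _ has_fourier_fun_measurable[OF U(1)] Ht U(2)]) simp
  also have "\<dots> = 2 * energy t H + 2 * (W2_dist t e0 g2)\<^sup>2"
    using W2_norm_square[OF U(1), of t] by (simp add: W2_dist_def u_def)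
  also have "\<dots> \<le> 2 * (?A\<^sup>2 * (W2_norm k f)\<^sup>2) + 2 * ((4 * ?A\<^sup>2 + (1 / 2) ^ N) * ((W2_norm k f)\<^sup>2 / 4))"
  proof (intro add_mono mult_left_mono)
    have "energy t H \<le> (\<rho> powr (t - s))\<^sup>2 * (c\<^sup>2 * (W2_norm k f)\<^sup>2)"
      using Ht' mult_left_mono[OF energyE, of "(\<rho> powr (t - s))\<^sup>2"] by simp
    then show "energy t H \<le> ?A\<^sup>2 * (W2_norm k f)\<^sup>2"
      by (simp add: power_mult_distrib mult_ac)
    have "(4 * ?A\<^sup>2 + (1 / 2) ^ N) * (W2_norm k e0)\<^sup>2 \<le> (4 * ?A\<^sup>2 + (1 / 2) ^ N) * ((W2_norm k f)\<^sup>2 / 4)"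
      by (intro mult_left_mono e0_norm) simp
    with g2(2) show "(W2_dist t e0 g2)\<^sup>2 \<le> (4 * ?A\<^sup>2 + (1 / 2) ^ N) * ((W2_norm k f)\<^sup>2 / 4)"
      by linarith
  qed simp_all
  also have "\<dots> = (4 * ?A\<^sup>2 + (1 / 2) ^ Suc N) * (W2_norm k f)\<^sup>2"
    by (simp add: algebra_simps)
  finally show ?case
    using S(3)[OF g1(1) g2(1)] by blast
qed

theorem proposition27:
  fixes s k t :: real and \<Phi> :: "(real ^ 'n::finite) distr set"
  assumes "k \<ge> 0" and "k > s"
    and "finite \<Phi>" and "\<Phi> \<subseteq> W2 s"
    and "provides_approximation_order s k (SI_space s \<Phi>)"
    and "t \<le> s"
  shows "provides_approximation_order t k (SI_space t \<Phi>)"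
proof -
  obtain C :: real where C: "\<And>f h. f \<in> W2 k \<Longrightarrow> h > 0 \<Longrightarrow>
      (INF g\<in>dilate h ` SI_space s \<Phi>. W2_dist s f g) \<le> C * h powr (k - s) * W2_norm k f"
    using assms(5) unfolding provides_approximation_order_def by blast
  let ?S = "\<lambda>h. dilate h ` SI_space s \<Phi>"
  let ?T = "\<lambda>h. dilate h ` SI_space t \<Phi>"
  have ST: "?S h \<subseteq> ?T h" for h
    using SI_space_mono[OF assms(4,6)] by blast
  have S_W2: "?S h \<subseteq> W2 s" if "h > 0" for h
    using SI_space_subset[OF assms(4)] W2_dilate[OF _ that] by blast
  have S0: "(\<lambda>\<phi>. 0) \<in> ?S h" for h
    by (rule image_eqI[of _ _ "\<lambda>\<phi>. 0"]) (auto simp: dilate_def SI_space_zero)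
  have S_add: "(\<lambda>\<phi>. f \<phi> + g \<phi>) \<in> ?S h" if "f \<in> ?S h" "g \<in> ?S h" for f g h
  proof -
    obtain f' g' where "f' \<in> SI_space s \<Phi>" "f = dilate h f'" "g' \<in> SI_space s \<Phi>" "g = dilate h g'"
      using \<open>f \<in> ?S h\<close> \<open>g \<in> ?S h\<close> by blast
    then show ?thesis
      by (intro image_eqI[of _ _ "\<lambda>\<phi>. f' \<phi> + g' \<phi>"]) (auto simp: dilate_def distrib_left SI_space_add)
  qed
  have bdd: "bdd_below (W2_dist r f ` X)" for r X and f :: "(real ^ 'n) distr"
    by (rule bdd_belowI2[of _ 0]) (simp add: W2_dist_def W2_norm_nonneg)
  have inf_le: "(INF g\<in>?T h. W2_dist t f g) \<le> W2_dist t f g" if "g \<in> ?S h" for f g h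
    using that ST by (intro cINF_lower bdd) blast
  \<comment> \<open>The infimum need not be attained, so the constant is enlarged strictly.\<close>
  define C' where "C' = max C 0 + 1"
  have C': "C' \<ge> 1" "C < C'"
    unfolding C'_def by auto
  have near: "\<exists>g\<in>?S h. W2_dist s f g \<le> C' * h powr (k - s) * W2_norm k f"
    if f: "f \<in> W2 k" and h: "h > 0" for f h
  proof (cases "W2_norm k f = 0")
    case True
    have "W2_norm s f \<le> W2_norm k f"
      using f assms(2) by (intro W2_norm_mono) auto
    with True S0 show ?thesis
      by (intro bexI[of _ "\<lambda>\<phi>. 0"]) (simp_all add: W2_dist_def)
  next
    case False
    then have "W2_norm k f > 0"
      using W2_norm_nonneg[of k f] by simp
    then have "C * h powr (k - s) * W2_norm k f < C' * h powr (k - s) * W2_norm k f"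
      using h C' by (intro mult_strict_right_mono) auto
    with C[OF f h] have "(INF g\<in>?S h. W2_dist s f g) < C' * h powr (k - s) * W2_norm k f"
      by linarith
    then show ?thesis
      using S0[of h] by (subst (asm) cINF_less_iff[OF _ bdd]) (auto intro: less_imp_le)
  qed
  \<comment> \<open>For \<open>h < \<epsilon>\<close> frequencies are cut at \<open>\<rho> = \<epsilon> / h\<close>; then
    \<open>C' * h powr (k - s) * \<rho> powr (k - s) = 1 / 2\<close> for all \<open>h\<close>, which is the contraction needed.\<close>
  define \<epsilon> where "\<epsilon> = (1 / (2 * C')) powr (1 / (k - s))"
  have \<epsilon>: "\<epsilon> > 0" "C' * \<epsilon> powr (k - s) = 1 / 2"
    using C' assms(2) by (auto simp: \<epsilon>_def powr_powr)
  define D where "D = max (2 * C' * \<epsilon> powr (t - s)) (\<epsilon> powr (t - k))"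
  have "(INF g\<in>?T h. W2_dist t f g) \<le> D * h powr (k - t) * W2_norm k f"
    if f: "f \<in> W2 k" and h: "h > 0" for f h
  proof (cases "h < \<epsilon>")
    case True
    let ?c = "C' * h powr (k - s)"
    let ?A = "?c * (\<epsilon> / h) powr (t - s)"
    have small: "?c * (\<epsilon> / h) powr (k - s) \<le> 1 / 2"
      using \<epsilon> h by (simp add: powr_divide)
    have A: "?A = C' * \<epsilon> powr (t - s) * h powr (k - t)"
    proof -
      have "h powr (k - s) = h powr (k - t) * h powr (t - s)"
        by (simp add: powr_add[symmetric])
      then show ?thesis
        using h \<epsilon>(1) by (simp add: powr_divide)
    qed
    have c0: "?c \<ge> 0" using C' by simp
    let ?I = "INF g\<in>?T h. W2_dist t f g"
    have I0: "?I \<ge> 0"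
      using S0[of h] ST by (intro cINF_greatest) (auto simp: W2_dist_def W2_norm_nonneg)
    have "?I\<^sup>2 \<le> (4 * ?A\<^sup>2 + (1 / 2) ^ N) * (W2_norm k f)\<^sup>2" for N
    proof -
      have "1 < \<epsilon> / h" using True h by simp
      obtain g where g: "g \<in> ?S h" "(W2_dist t f g)\<^sup>2 \<le> (4 * ?A\<^sup>2 + (1 / 2) ^ N) * (W2_norm k f)\<^sup>2"
        using approximation_transfer[OF S_W2[OF h] S0 S_add assms(6,2) c0 \<open>1 < \<epsilon> / h\<close> small near[OF _ h] f, of N]
        by blast
      have "?I\<^sup>2 \<le> (W2_dist t f g)\<^sup>2"
        by (intro power_mono inf_le g(1) I0)
      with g(2) show ?thesis by linarith
    qed
    moreover have "(\<lambda>N. (4 * ?A\<^sup>2 + (1 / 2) ^ N) * (W2_norm k f)\<^sup>2) \<longlonglongrightarrow> (4 * ?A\<^sup>2 + 0) * (W2_norm k f)\<^sup>2"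
      by (intro tendsto_intros LIMSEQ_power_zero) simp
    ultimately have "?I\<^sup>2 \<le> (4 * ?A\<^sup>2 + 0) * (W2_norm k f)\<^sup>2"
      by (intro LIMSEQ_le_const[where X="\<lambda>N. (4 * ?A\<^sup>2 + (1 / 2) ^ N) * (W2_norm k f)\<^sup>2"]) auto
    then have "?I\<^sup>2 \<le> (2 * ?A * W2_norm k f)\<^sup>2"
      by (simp add: power_mult_distrib)
    then have "?I \<le> 2 * ?A * W2_norm k f"
      by (rule power2_le_imp_le) (use C' W2_norm_nonneg[of k f] in \<open>intro mult_nonneg_nonneg; simp\<close>)
    also have "\<dots> = (2 * C' * \<epsilon> powr (t - s)) * h powr (k - t) * W2_norm k f"
      unfolding A by simp
    also have "\<dots> \<le> D * h powr (k - t) * W2_norm k f"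
      by (intro mult_right_mono) (auto simp: D_def W2_norm_nonneg)
    finally show ?thesis .
  next
    case False
    \<comment> \<open>Large \<open>h\<close>: approximation by \<open>0\<close>.\<close>
    have "(INF g\<in>?T h. W2_dist t f g) \<le> W2_norm t f"
      using inf_le[OF S0, of f h] by (simp add: W2_dist_def)
    also have "\<dots> \<le> 1 * W2_norm k f"
      using W2_norm_mono[OF f, of t] assms(2,6) by simp
    also have "\<dots> \<le> (D * h powr (k - t)) * W2_norm k f"
    proof (intro mult_right_mono W2_norm_nonneg)
      have "1 = \<epsilon> powr (t - k) * \<epsilon> powr (k - t)"
        using \<epsilon>(1) by (simp add: powr_add[symmetric])
      also have "\<dots> \<le> D * h powr (k - t)"
        using False \<epsilon>(1) assms(2,6) by (intro mult_mono powr_mono2) (auto simp: D_def le_max_iff_disj)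
      finally show "1 \<le> D * h powr (k - t)" .
    qed
    finally show ?thesis .
  qed
  then show ?thesis
    unfolding provides_approximation_order_def by blast
qed

end
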